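(* Let $\mathcal{P}\subset M_2(\mathbb{R})$ denote the set of all non-nilpotent rank-one matrices and $\mathcal{E}\subset M_2(\mathbb{R})$ the set of all matrices with non-real eigenvalues. Define four subsets $\mathcal{U}_1,\mathcal{U}_2,\mathcal{U}_3,\mathcal{U}_4$ of $\mathcal{P}\times\mathcal{E}$ as follows, where continuity refers to the function $\underline{\varrho}\colon\mathcal{P}\times\mathcal{E}\to\mathbb{R}$: (1) $\mathcal{U}_1$ is the set of all $\mathsf{A}\in\mathcal{P}\times\mathcal{E}$ such that $\underline{\varrho}(\mathsf{A})=0$, $\underline{\varrho}$ is continuous at $\mathsf{A}$, and $\mathsf{A}$ does not have the lower finiteness property; (2) $\mathcal{U}_2$ is the set of all $\mathsf{A}\in\mathcal{P}\times\mathcal{E}$ such that $\underline{\varrho}(\mathsf{A})=0$, $\underline{\varrho}$ is continuous at $\mathsf{A}$, and $\mathsf{A}$ has the lower finiteness property; (3) $\mathcal{U}_3$ is the set of all $\mathsf{A}\in\mathcal{P}\times\mathcal{E}$ such that $\underline{\varrho}(\mathsf{A})>0$, $\underline{\varrho}$ is discontinuous at $\mathsf{A}$, and $\mathsf{A}$ does not have the lower finiteness property; (4) $\mathcal{U}_4$ is the set of all $\mathsf{A}\in\mathcal{P}\times\mathcal{E}$ such that $\underline{\varrho}(\mathsf{A})>0$, $\underline{\varrho}$ is discontinuous at $\mathsf{A}$, and $\mathsf{A}$ has the lower finiteness property. Then $\mathcal{P}\times\mathcal{E}=\mathcal{U}_1\cup\mathcal{U}_2\cup\mathcal{U}_3\cup\mathcal{U}_4$,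 and each of the four sets $\mathcal{U}_i$ is dense in $\mathcal{P}\times\mathcal{E}$. The set $\mathcal{U}_1$ is equal to a countable intersection of dense open subsets of $\mathcal{P}\times\mathcal{E}$; conversely, the set $\mathcal{U}_4$ is of full Lebesgue measure in $\mathcal{P}\times\mathcal{E}$.
   Context: $M_2(\mathbb{R})$ is the space of $2\times2$ real matrices and $\rho$ is the ordinary spectral radius. For a pair $\mathsf{A}=(A_1,A_2)\in M_2(\mathbb{R})^2$ the lower spectral radius is $\underline{\varrho}(\mathsf{A})=\lim_{n\to\infty}\min\{\|A_{i_n}\cdots A_{i_1}\|^{1/n}\colon i_1,\dots,i_n\in\{1,2\}\}$ (independent of the choice of norm). The pair $\mathsf{A}$ has the lower finiteness property if there exist $n\ge1$ and $i_1,\dots,i_n\in\{1,2\}$ such that $\underline{\varrho}(\mathsf{A})=\rho(A_{i_1}\cdots A_{i_n})^{1/n}$. The set $\mathcal{P}\times\mathcal{E}$ carries the subspace topology from $M_2(\mathbb{R})^2\cong\mathbb{R}^8$ and is a seven-dimensional smooth submanifold of it ($\mathcal{P}$ is a three-dimensional submanifold and $\mathcal{E}$ is open in $M_2(\mathbb{R})$); "full Lebesgue measure" means that the complement in $\mathcal{P}\times\mathcal{E}$ has zero seven-dimensional Lebesgue measure (is null in every smooth chart). *)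

theory Defs
  imports "HOL-Analysis.Analysis"
begin

type_synonym mat2 = "real^2^2"

section \<open>Spectral radius and nilpotency\<close>

definition complex_eigenvalues :: "mat2 \<Rightarrow> complex set" where
  "complex_eigenvalues A =
     {z. \<exists>v::complex^2. v \<noteq> 0 \<and> map_matrix complex_of_real A *v v = z *s v}"

definition spectral_radius :: "mat2 \<Rightarrow> real" where
  "spectral_radius A = Max (cmod ` complex_eigenvalues A)"

text \<open>The type class operation \<open>(^)\<close> on \<^typ>\<open>real^2^2\<close> is the entrywise power,
  hence the explicit iteration of the matrix product.\<close>
definition nilpotent_matrix :: "mat2 \<Rightarrow> bool" where
  "nilpotent_matrix A \<longleftrightarrow> (\<exists>k. (((**) A) ^^ k) (mat 1) = 0)"

section \<open>Products along words and the lower spectral radius\<close>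

definition letter :: "mat2 \<times> mat2 \<Rightarrow> nat \<Rightarrow> mat2" where
  "letter A i = (if i = 1 then fst A else snd A)"

definition words :: "nat \<Rightarrow> nat list set" where
  "words n = {w. length w = n \<and> set w \<subseteq> {1, 2}}"

text \<open>The word \<open>[i\<^sub>1, \<dots>, i\<^sub>n]\<close> is mapped to \<open>A\<^bsub>i\<^sub>n\<^esub> \<cdots> A\<^bsub>i\<^sub>1\<^esub>\<close>.\<close>
fun word_prod :: "mat2 \<times> mat2 \<Rightarrow> nat list \<Rightarrow> mat2" where
  "word_prod A [] = mat 1"
| "word_prod A (i # w) = word_prod A w ** letter A i"

text \<open>The norm on \<^typ>\<open>real^2^2\<close> is the Frobenius norm; the limit does not depend on
  the choice of norm.\<close>
definition lower_spectral_radius :: "mat2 \<times> mat2 \<Rightarrow> real" where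
  "lower_spectral_radius A =
     lim (\<lambda>n. Min ((\<lambda>w. root n (norm (word_prod A w))) ` words n))"

definition lower_finiteness_property :: "mat2 \<times> mat2 \<Rightarrow> bool" where
  "lower_finiteness_property A \<longleftrightarrow>
     (\<exists>n\<ge>1. \<exists>w\<in>words n. lower_spectral_radius A = root n (spectral_radius (word_prod A w)))"

section \<open>The sets of matrices and of pairs\<close>

definition PP :: "mat2 set" where
  "PP = {A. rank A = 1 \<and> \<not> nilpotent_matrix A}"

definition EE :: "mat2 set" where
  "EE = {B. \<forall>z\<in>complex_eigenvalues B. z \<notin> \<real>}"

definition U1 :: "(mat2 \<times> mat2) set" where
  "U1 = {A \<in> PP \<times> EE. lower_spectral_radius A = 0 \<and>
           continuous (at A within PP \<times> EE) lower_spectral_radius \<and>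
           \<not> lower_finiteness_property A}"

definition U2 :: "(mat2 \<times> mat2) set" where
  "U2 = {A \<in> PP \<times> EE. lower_spectral_radius A = 0 \<and>
           continuous (at A within PP \<times> EE) lower_spectral_radius \<and>
           lower_finiteness_property A}"

definition U3 :: "(mat2 \<times> mat2) set" where
  "U3 = {A \<in> PP \<times> EE. lower_spectral_radius A > 0 \<and>
           \<not> continuous (at A within PP \<times> EE) lower_spectral_radius \<and>
           \<not> lower_finiteness_property A}"

definition U4 :: "(mat2 \<times> mat2) set" where
  "U4 = {A \<in> PP \<times> EE. lower_spectral_radius A > 0 \<and>
           \<not> continuous (at A within PP \<times> EE) lower_spectral_radius \<and>
           lower_finiteness_property A}"

definition dense_within :: "'a::topological_space set \<Rightarrow> 'a set \<Rightarrow> bool" where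
  "dense_within X S \<longleftrightarrow> S \<subseteq> X \<and> top_of_set X closure_of S = X"

section \<open>Null sets of seven-dimensional submanifolds\<close>

text \<open>For open \<open>S\<close>: \<open>f\<close> is \<open>k\<close> times continuously differentiable on \<open>S\<close>.\<close>
fun Ck_on :: "nat \<Rightarrow> ('a::euclidean_space \<Rightarrow> 'b::euclidean_space) \<Rightarrow> 'a set \<Rightarrow> bool" where
  "Ck_on 0 f S \<longleftrightarrow> continuous_on S f"
| "Ck_on (Suc k) f S \<longleftrightarrow>
     (\<forall>x\<in>S. f differentiable at x) \<and>
     (\<forall>v. Ck_on k (\<lambda>x. frechet_derivative f (at x) v) S)"

definition smooth_on :: "('a::euclidean_space \<Rightarrow> 'b::euclidean_space) \<Rightarrow> 'a set \<Rightarrow> bool" where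
  "smooth_on f S \<longleftrightarrow> (\<forall>k. Ck_on k f S)"

text \<open>\<open>\<phi>\<close> is the inverse of a smooth chart of the embedded submanifold \<open>M\<close>: a smooth immersion
  of the open set \<open>V\<close> which is a homeomorphism onto a relatively open subset of \<open>M\<close>.\<close>
definition smooth_parametrization ::
    "'b::euclidean_space set \<Rightarrow> 'a::euclidean_space set \<Rightarrow> ('a \<Rightarrow> 'b) \<Rightarrow> bool" where
  "smooth_parametrization M V \<phi> \<longleftrightarrow>
     open V \<and> smooth_on \<phi> V \<and>
     (\<forall>x\<in>V. inj (frechet_derivative \<phi> (at x))) \<and>
     openin (top_of_set M) (\<phi> ` V) \<and>
     (\<exists>\<psi>. homeomorphism V (\<phi> ` V) \<phi> \<psi>)"

text \<open>\<open>M\<close> is meant to be a seven-dimensional embedded submanifold; otherwise it need not be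
  covered by such charts.\<close>
definition null_in_7_submanifold :: "'b::euclidean_space set \<Rightarrow> 'b set \<Rightarrow> bool" where
  "null_in_7_submanifold M N \<longleftrightarrow>
     N \<subseteq> M \<and>
     (\<forall>(V :: (real^7) set) \<phi>. smooth_parametrization M V \<phi> \<longrightarrow>
        {x \<in> V. \<phi> x \<in> N} \<in> null_sets lebesgue)"

definition full_measure_in_7_submanifold :: "'b::euclidean_space set \<Rightarrow> 'b set \<Rightarrow> bool" where
  "full_measure_in_7_submanifold M S \<longleftrightarrow> S \<subseteq> M \<and> null_in_7_submanifold M (M - S)"

end

theory Submission
  imports Defs
begin

text \<open>
  Write \<open>B = r (cos \<theta> I + sin \<theta> J)\<close> with \<open>J\<^sup>2 = -I\<close> and \<open>t\<^sub>k = tr (P B\<^sup>k)\<close>. Since \<open>P X P = tr (P X) P\<close>,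
  every product containing \<open>P\<close> splits into factors \<open>t\<^sub>k\<close>, so the lower spectral radius is the infimum
  of \<open>r\<close> and all \<open>root (k+1) \<bar>t\<^sub>k\<bar>\<close>, and the lower finiteness property says that this infimum is attained.
  Here \<open>t\<^sub>k = r\<^sup>k (p cos k\<theta> + q sin k\<theta>)\<close> with \<open>p = tr P\<close> and \<open>q = tr (P J)\<close>, and only \<open>\<theta>\<close> needs to be varied.
  The radius vanishes on a dense set, where some \<open>t\<^sub>k\<close> is zero; being upper semicontinuous, it is continuous
  exactly where it is zero. By the Borel--Cantelli lemma almost every \<open>\<theta>\<close> satisfies
  \<open>\<bar>t\<^sub>k\<bar> \<ge> r\<^sup>k / k\<^sup>2\<close> for large \<open>k\<close>, whence the infimum is positive and attained. Positive infima that are not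
  attained come from the Baire category theorem on a superlevel set of the radius.
\<close>

section \<open>Real two-by-two matrices\<close>

text \<open>The hard case is a positive radius that is not attained. For fixed P, J and r let F be
  the set of angles of rate at least \<epsilon>. It is closed but contains no interval, because
  zeros of the waves are dense, so the Baire argument has to run inside F. A residual point of F
  should have rate exactly \<epsilon> while every single term stays strictly above that level. This
  needs two dense subsets of F. Angles of rate above \<epsilon> are dense once \<epsilon> avoids all
  local suprema. For angles of rate below \<epsilon> + 1/k measure is used: at the end of a gap of
  F, a rate well above \<epsilon> would force points of F into the gap, since only waves of high
  index can be small there and their sublevel sets decay geometrically. The bound 1/k^2 is summable,
  as Borel--Cantelli demands, and its k-th root tends to 1, so it does not disturb the comparison
  with r. For the null set, the lines B + s I keep P and J fixed and move only the polar coordinates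
  of B, so Tonelli reduces seven dimensions to one.\<close>

abbreviation mat_power :: "mat2 \<Rightarrow> nat \<Rightarrow> mat2" where
  "mat_power B n \<equiv> (((**) B) ^^ n) (mat 1)"

lemma mat2_eq_iff:
  fixes A B :: "'a^2^2"
  shows "A = B \<longleftrightarrow> A$1$1 = B$1$1 \<and> A$1$2 = B$1$2 \<and> A$2$1 = B$2$1 \<and> A$2$2 = B$2$2"
  by (auto simp: vec_eq_iff forall_2)

lemma mat2_mult_nth:
  fixes A B :: "'a::semiring_1^2^2"
  shows "(A ** B)$i$j = A$i$1 * B$1$j + A$i$2 * B$2$j"
  by (simp add: matrix_matrix_mult_def sum_2)

lemma mat2_one_nth:
  "(mat 1 :: 'a::{zero,one}^2^2)$1$1 = 1" "(mat 1 :: 'a::{zero,one}^2^2)$1$2 = 0"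
  "(mat 1 :: 'a::{zero,one}^2^2)$2$1 = 0" "(mat 1 :: 'a::{zero,one}^2^2)$2$2 = 1"
  by (simp_all add: mat_def)

lemma trace_2: "trace (A :: 'a::comm_semiring_1^2^2) = A$1$1 + A$2$2"
  by (simp add: trace_def sum_2)

lemmas mat2_simps = mat2_eq_iff mat2_mult_nth mat2_one_nth trace_2 det_2

section \<open>Eigenvalues through trace and determinant\<close>

lemma complex_eigenvalues_iff:
  "z \<in> complex_eigenvalues A \<longleftrightarrow> z\<^sup>2 - of_real (trace A) * z + of_real (det A) = 0"
proof -
  define C :: "complex^2^2" where "C = (\<chi> i j. complex_of_real (A$i$j) - (if i = j then z else 0))"
  have *: "map_matrix complex_of_real A *v v = z *s v \<longleftrightarrow> C *v v = 0" for v
    by (auto simp: vec_eq_iff forall_2 matrix_vector_mult_def sum_2 C_def map_matrix_def algebra_simps)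
  have "z \<in> complex_eigenvalues A \<longleftrightarrow> \<not> (\<forall>v. C *v v = 0 \<longrightarrow> v = 0)"
    unfolding complex_eigenvalues_def using * by auto
  also have "\<dots> \<longleftrightarrow> \<not> invertible C"
    unfolding matrix_left_invertible_ker[symmetric] invertible_left_inverse ..
  also have "\<dots> \<longleftrightarrow> det C = 0"
    by (simp add: invertible_det_nz)
  also have "det C = z\<^sup>2 - of_real (trace A) * z + of_real (det A)"
    by (simp add: C_def mat2_simps algebra_simps power2_eq_square)
  finally show ?thesis .
qed

lemma EE_iff: "B \<in> EE \<longleftrightarrow> (trace B)\<^sup>2 < 4 * det B"
proof
  assume B: "B \<in> EE"
  show "(trace B)\<^sup>2 < 4 * det B"
  proof (rule ccontr)
    assume "\<not> ?thesis"
    then have nn: "(trace B)\<^sup>2 - 4 * det B \<ge> 0" by simp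
    define x where "x = (trace B + sqrt ((trace B)\<^sup>2 - 4 * det B)) / 2"
    have "2 * x - trace B = sqrt ((trace B)\<^sup>2 - 4 * det B)"
      by (simp add: x_def field_simps)
    then have "(2 * x - trace B)\<^sup>2 = (trace B)\<^sup>2 - 4 * det B"
      using nn by simp
    then have "x\<^sup>2 - trace B * x + det B = 0"
      by (simp add: power2_eq_square algebra_simps)
    then have "complex_of_real (x\<^sup>2 - trace B * x + det B) = 0" by simp
    then have "complex_of_real x \<in> complex_eigenvalues B"
      unfolding complex_eigenvalues_iff by simp
    with B show False unfolding EE_def by auto
  qed
next
  assume lt: "(trace B)\<^sup>2 < 4 * det B"
  show "B \<in> EE" unfolding EE_def
  proof safe
    fix z assume z: "z \<in> complex_eigenvalues B" "z \<in> \<real>"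
    then obtain x where x: "z = of_real x" by (auto elim: Reals_cases)
    have "complex_of_real (x\<^sup>2 - trace B * x + det B) = 0"
      using z(1) unfolding complex_eigenvalues_iff x by simp
    then have "x\<^sup>2 - trace B * x + det B = 0" using of_real_eq_0_iff by blast
    then have "(2 * x - trace B)\<^sup>2 = (trace B)\<^sup>2 - 4 * det B"
      by (simp add: power2_eq_square algebra_simps)
    with lt zero_le_power2[of "2 * x - trace B"] show False by linarith
  qed
qed

lemma spectral_radius_det_0:
  assumes "det A = 0" shows "spectral_radius A = \<bar>trace A\<bar>"
proof -
  have "complex_eigenvalues A = {0, of_real (trace A)}"
    using assms by (auto simp: complex_eigenvalues_iff power2_eq_square)
  then show ?thesis by (simp add: spectral_radius_def)
qed

lemma spectral_radius_nonreal:
  assumes "(trace A)\<^sup>2 \<le> 4 * det A" shows "spectral_radius A = sqrt (det A)"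
proof -
  define s where "s = sqrt (4 * det A - (trace A)\<^sup>2)"
  have s: "s\<^sup>2 = 4 * det A - (trace A)\<^sup>2" using assms by (simp add: s_def)
  have fac: "z\<^sup>2 - of_real (trace A) * z + of_real (det A)
      = (z - Complex (trace A / 2) (s / 2)) * (z - Complex (trace A / 2) (- s / 2))" for z
  proof -
    have "4 * det A = s\<^sup>2 + (trace A)\<^sup>2" using s by simp
    then have d: "det A = (s\<^sup>2 + (trace A)\<^sup>2) / 4" by simp
    show ?thesis unfolding d
      by (simp add: complex_eq_iff power2_eq_square field_simps)
  qed
  have "complex_eigenvalues A = {Complex (trace A / 2) (s / 2), Complex (trace A / 2) (- s / 2)}"
    unfolding set_eq_iff complex_eigenvalues_iff fac by auto
  moreover have "(trace A)\<^sup>2 / 4 + s\<^sup>2 / 4 = det A" using s by (simp add: field_simps)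
  then have "cmod (Complex (trace A / 2) (s / 2)) = sqrt (det A)"
    "cmod (Complex (trace A / 2) (- s / 2)) = sqrt (det A)"
    using \<open>(trace A)\<^sup>2 / 4 + s\<^sup>2 / 4 = det A\<close> by (simp_all add: cmod_def power_divide)
  ultimately show ?thesis by (simp add: spectral_radius_def)
qed

lemma trace_scaleR: "trace (c *\<^sub>R A) = c * trace (A :: real^'n^'n)"
  by (simp add: trace_def sum_distrib_left)

lemma mat2_mult_scaleR:
  fixes A B :: mat2
  shows "(c *\<^sub>R A) ** B = c *\<^sub>R (A ** B)" "A ** (c *\<^sub>R B) = c *\<^sub>R (A ** B)"
  by (simp_all add: mat2_simps algebra_simps)

text \<open>A singular P has the form u v^T, and u v^T X u v^T = (v^T X u) u v^T, where the scalar
  is the trace of u v^T X.\<close>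

lemma rank_one_sandwich:
  fixes P X :: mat2
  assumes "det P = 0"
  shows "P ** X ** P = trace (P ** X) *\<^sub>R P"
proof -
  have d: "P$1$1 * P$2$2 = P$1$2 * P$2$1" using assms by (simp add: det_2)
  show ?thesis using d by (simp add: mat2_simps) algebra
qed

lemma mat_power_rank_one:
  assumes "det P = 0"
  shows "mat_power P (Suc n) = trace P ^ n *\<^sub>R P"
proof (induction n)
  case (Suc n)
  have "P ** P = trace P *\<^sub>R P" using rank_one_sandwich[OF assms, of "mat 1"] by simp
  with Suc show ?case by (simp add: mat2_mult_scaleR mult.commute)
qed simp

text \<open>A singular P satisfies P^2 = tr(P) P, so its nilpotency is decided by the trace; a
  nonzero trace also rules out rank zero.\<close>

lemma PP_iff: "P \<in> PP \<longleftrightarrow> det P = 0 \<and> trace P \<noteq> 0"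
proof -
  have rk: "rank P = 1 \<longleftrightarrow> det P = 0 \<and> P \<noteq> 0"
  proof -
    have "rank P \<le> 2" using rank_bound[of P] by simp
    moreover have "rank P < 2 \<longleftrightarrow> det P = 0" using det_eq_0_rank[of P] by simp
    moreover have "rank P = 0 \<longleftrightarrow> P = 0" by (rule rank_eq_0)
    ultimately show ?thesis by linarith
  qed
  have "nilpotent_matrix P \<longleftrightarrow> trace P = 0" if d: "det P = 0" "P \<noteq> 0"
  proof
    assume "nilpotent_matrix P"
    then obtain k where k: "mat_power P k = 0" unfolding nilpotent_matrix_def by blast
    show "trace P = 0"
    proof (cases k)
      case 0
      then show ?thesis using k by (simp add: mat2_eq_iff mat2_one_nth)
    next
      case (Suc n)
      then show ?thesis using k mat_power_rank_one[OF d(1), of n] d(2) by simp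
    qed
  next
    assume "trace P = 0"
    then have "mat_power P (Suc (Suc 0)) = 0"
      unfolding mat_power_rank_one[OF d(1)] by simp
    then show "nilpotent_matrix P" unfolding nilpotent_matrix_def by blast
  qed
  moreover have "P \<noteq> 0" if "trace P \<noteq> 0" using that by (auto simp: trace_2)
  ultimately show ?thesis unfolding PP_def using rk by auto
qed

text \<open>A linear complex structure \<open>J\<close> turns \<open>span {I, J}\<close> into a copy of the complex numbers;
  \<open>rot r \<theta> J\<close> is the element with polar coordinates \<open>(r, \<theta>)\<close>.\<close>
definition rot :: "real \<Rightarrow> real \<Rightarrow> mat2 \<Rightarrow> mat2" where
  "rot r \<theta> J = (r * cos \<theta>) *\<^sub>R mat 1 + (r * sin \<theta>) *\<^sub>R J"

lemma complex_structure_trace_det: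
  fixes J :: mat2
  assumes "J ** J = - mat 1"
  shows "trace J = 0" "det J = 1"
proof -
  let ?a = "J$1$1" and ?b = "J$1$2" and ?c = "J$2$1" and ?d = "J$2$2"
  have e: "?a * ?a + ?b * ?c = -1" "?a * ?b + ?b * ?d = 0"
    using assms by (simp_all add: mat2_simps)
  have "?b \<noteq> 0"
  proof
    assume "?b = 0"
    with e(1) have "?a * ?a = -1" by simp
    then show False using zero_le_square[of ?a] by linarith
  qed
  moreover have "?b * (?a + ?d) = 0" using e(2) by (simp add: algebra_simps)
  ultimately have t: "?a + ?d = 0" by simp
  then show "trace J = 0" by (simp add: trace_2)
  have "?d = - ?a" using t by simp
  then show "det J = 1" using e(1) by (simp add: det_2)
qed

lemma rot_mult:
  assumes "J ** J = - mat 1"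
  shows "rot r a J ** rot s b J = rot (r * s) (a + b) J"
proof -
  let ?a = "J$1$1" and ?b = "J$1$2" and ?c = "J$2$1" and ?d = "J$2$2"
  have e: "?a * ?a + ?b * ?c = -1" "?a * ?b + ?b * ?d = 0" "?c * ?a + ?d * ?c = 0" "?c * ?b + ?d * ?d = -1"
    using assms by (simp_all add: mat2_simps)
  show ?thesis unfolding rot_def cos_add sin_add using e
    apply (simp add: mat2_simps)
    apply (intro conjI)
    by algebra+
qed

lemma mat_power_rot:
  assumes "J ** J = - mat 1"
  shows "mat_power (rot r \<theta> J) n = rot (r ^ n) (n * \<theta>) J"
proof (induction n)
  case 0
  then show ?case by (simp add: rot_def)
next
  case (Suc n)
  then show ?case by (simp add: rot_mult[OF assms] algebra_simps)
qed

lemma trace_rot: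
  fixes J :: mat2
  shows "J ** J = - mat 1 \<Longrightarrow> trace (rot r \<theta> J) = 2 * r * cos \<theta>"
  using complex_structure_trace_det(1)[of J] by (simp add: rot_def mat2_simps) algebra

lemma det_rot:
  fixes J :: mat2
  assumes "J ** J = - mat 1"
  shows "det (rot r \<theta> J) = r\<^sup>2"
proof -
  have "J$2$2 = - J$1$1" "J$1$1 * J$2$2 - J$1$2 * J$2$1 = 1"
    using complex_structure_trace_det[OF assms] by (simp_all add: mat2_simps)
  then have "det (rot r \<theta> J) = (r * cos \<theta>)\<^sup>2 + (r * sin \<theta>)\<^sup>2 * 1"
    by (simp add: rot_def mat2_simps) algebra
  also have "\<dots> = r\<^sup>2 * ((cos \<theta>)\<^sup>2 + (sin \<theta>)\<^sup>2)"
    by (simp only: power_mult_distrib distrib_left mult_1_right)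
  finally show ?thesis by simp
qed

lemma rot_in_EE:
  assumes "J ** J = - mat 1" "r > 0" "0 < \<theta>" "\<theta> < pi"
  shows "rot r \<theta> J \<in> EE"
proof -
  have "r\<^sup>2 * (sin \<theta>)\<^sup>2 > 0" using assms sin_gt_zero[of \<theta>] by simp
  then show ?thesis
    by (simp add: EE_iff det_rot[OF assms(1)] trace_rot[OF assms(1)] cos_squared_eq power_mult_distrib algebra_simps)
qed

lemma polar_upper_half_plane:
  assumes "b > 0"
  obtains r \<theta> where "r > 0" "0 < \<theta>" "\<theta> < pi" "a = r * cos \<theta>" "b = r * sin \<theta>"
proof -
  define z where "z = Complex a b"
  have z: "z = rcis (cmod z) (Arg z)" by (simp add: rcis_cmod_Arg)
  have "Im z > 0" using assms by (simp add: z_def)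
  then have "0 < Arg z" "Arg z < pi" "cmod z > 0" using Arg_lt_pi[of z] by auto
  moreover have "a = cmod z * cos (Arg z)" "b = cmod z * sin (Arg z)"
    using arg_cong[OF z, of Re] arg_cong[OF z, of Im] by (simp_all add: z_def)
  ultimately show ?thesis using that by blast
qed

text \<open>Cayley--Hamilton: if a is half the trace, then B - a I squares to (a^2 - det B) I = -b^2
  I, where b > 0 is the imaginary part of an eigenvalue. Hence J = (B - a I) / b, and (r, \<theta>)
  are the polar coordinates of a + i b.\<close>

lemma EE_rot_cases:
  assumes "B \<in> EE"
  obtains r \<theta> J where "r > 0" "0 < \<theta>" "\<theta> < pi" "J ** J = - mat 1" "B = rot r \<theta> J"
proof -
  define a where "a = trace B / 2"
  define b where "b = sqrt (det B - a\<^sup>2)"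
  have "det B - a\<^sup>2 > 0" using assms by (simp add: EE_iff a_def power_divide)
  then have b: "b > 0" "b\<^sup>2 = det B - a\<^sup>2" by (simp_all add: b_def)
  define J where "J = (1/b) *\<^sub>R (B - a *\<^sub>R mat 1)"
  have BJ: "B = a *\<^sub>R mat 1 + b *\<^sub>R J" using b by (simp add: J_def)
  have J: "J ** J = - mat 1"
  proof -
    let ?C = "B - a *\<^sub>R mat 1"
    have "?C ** ?C = (- b\<^sup>2) *\<^sub>R mat 1"
      unfolding b(2) a_def by (simp add: mat2_simps power2_eq_square field_simps)
    then have "J ** J = (1/b) *\<^sub>R ((1/b) *\<^sub>R ((- b\<^sup>2) *\<^sub>R mat 1))"
      unfolding J_def by (simp add: mat2_mult_scaleR)
    then show ?thesis using b by (simp add: power2_eq_square)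
  qed
  obtain r \<theta> where "r > 0" "0 < \<theta>" "\<theta> < pi" "a = r * cos \<theta>" "b = r * sin \<theta>"
    using polar_upper_half_plane[OF b(1)] by blast
  then show ?thesis using that[of r \<theta> J] J BJ by (simp add: rot_def)
qed

lemma trace_mult_rot:
  "trace (P ** rot r \<theta> J) = r * (trace P * cos \<theta> + trace (P ** J) * sin \<theta>)" for P J :: mat2
  by (simp add: rot_def mat2_simps algebra_simps)

section \<open>The lower spectral radius as an infimum of rates\<close>

definition trace_seq :: "mat2 \<times> mat2 \<Rightarrow> nat \<Rightarrow> real" where
  "trace_seq A n = trace (fst A ** mat_power (snd A) n)"

text \<open>Spectral radii normalised by word length: \<open>sqrt (det (snd A))\<close> comes from
  the single letter 2, and the k-th root from P B^k, a word of length k + 1 with singular product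
  and trace t_k.\<close>

definition rates :: "mat2 \<times> mat2 \<Rightarrow> real set" where
  "rates A = insert (sqrt (det (snd A))) (range (\<lambda>k. root (Suc k) \<bar>trace_seq A k\<bar>))"

lemma mat2_mult_norm_bound:
  obtains K where "K > 0" "\<And>(X :: mat2) (Y :: mat2). norm (X ** Y) \<le> K * norm X * norm Y"
proof -
  have "bilinear (\<lambda>(X :: mat2) (Y :: mat2). X ** Y)"
    unfolding bilinear_def by (auto intro!: linearI simp: mat2_simps algebra_simps)
  then interpret bounded_bilinear "\<lambda>(X :: mat2) (Y :: mat2). X ** Y"
    by (simp add: bilinear_conv_bounded_bilinear)
  show ?thesis using pos_bounded that by (metis mult.assoc mult.commute)
qed

lemma word_prod_append: "word_prod A (x @ y) = word_prod A y ** word_prod A x"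
  by (induction x) (auto simp: matrix_mul_assoc)

lemma words_finite: "finite (words n)" and words_nonempty: "words n \<noteq> {}"
proof -
  show "finite (words n)" unfolding words_def
    using finite_lists_length_eq[of "{1, 2 :: nat}" n] by (simp add: conj_commute)
  have "replicate n 1 \<in> words n" by (auto simp: words_def)
  then show "words n \<noteq> {}" by blast
qed

lemma mat_power_commute: "mat_power B n ** B = B ** mat_power B n"
  by (induction n) (auto simp: matrix_mul_assoc[symmetric])

lemma word_prod_replicate_2: "word_prod A (replicate n 2) = mat_power (snd A) n"
  by (induction n) (auto simp: letter_def mat_power_commute)

lemma word_prod_no_1: "set w \<subseteq> {1, 2} \<Longrightarrow> 1 \<notin> set w \<Longrightarrow> word_prod A w = mat_power (snd A) (length w)"
  by (induction w) (auto simp: letter_def mat_power_commute)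

text \<open>Constant factors disappear under n-th roots. The lower bound is uniform over all words,
  whereas in the upper bound each s may bring its own constant, because one s slightly above the
  infimum suffices for a given tolerance.\<close>

lemma Min_root_tendsto:
  fixes f :: "'a \<Rightarrow> real" and W :: "nat \<Rightarrow> 'a set"
  assumes fin: "\<And>n. finite (W n)" "\<And>n. W n \<noteq> {}" and c: "c > 0" and S: "S \<noteq> {}" "bdd_below S" "Inf S \<ge> 0"
    and low: "\<And>n w. w \<in> W n \<Longrightarrow> c * Inf S ^ n \<le> f w"
    and up: "\<And>s. s \<in> S \<Longrightarrow> \<exists>C>0. \<forall>\<^sub>F n in sequentially. \<exists>w\<in>W n. f w \<le> C * s ^ n"
  shows "(\<lambda>n. Min ((\<lambda>w. root n (f w)) ` W n)) \<longlonglongrightarrow> Inf S"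
proof (rule order_tendstoI)
  fix a assume a: "a < Inf S"
  have "(\<lambda>n. root n c * Inf S) \<longlonglongrightarrow> 1 * Inf S"
    by (intro tendsto_intros LIMSEQ_root_const c)
  then have "\<forall>\<^sub>F n in sequentially. a < root n c * Inf S"
    using a by (auto dest: order_tendstoD)
  then show "\<forall>\<^sub>F n in sequentially. a < Min ((\<lambda>w. root n (f w)) ` W n)"
    using eventually_gt_at_top[of 0]
  proof eventually_elim
    case (elim n)
    have "root n c * Inf S \<le> root n (f w)" if "w \<in> W n" for w
    proof -
      have "root n (c * Inf S ^ n) \<le> root n (f w)" using low[OF that] elim by simp
      then show ?thesis using elim S by (simp add: real_root_mult real_root_power_cancel)
    qed
    with elim fin show ?case by (fastforce simp: Min_gr_iff)
  qed
next
  fix a assume "Inf S < a"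
  then obtain s where s: "s \<in> S" "s < a" using S cInf_lessD by blast
  have s0: "s \<ge> 0" using s S cInf_lower[of s S] by simp
  obtain C where C: "C > 0" "\<forall>\<^sub>F n in sequentially. \<exists>w\<in>W n. f w \<le> C * s ^ n"
    using up[OF s(1)] by blast
  have "(\<lambda>n. root n C * s) \<longlonglongrightarrow> 1 * s"
    by (intro tendsto_intros LIMSEQ_root_const C)
  then have "\<forall>\<^sub>F n in sequentially. root n C * s < a"
    using s by (auto dest: order_tendstoD)
  then show "\<forall>\<^sub>F n in sequentially. Min ((\<lambda>w. root n (f w)) ` W n) < a"
    using C(2) eventually_gt_at_top[of 0]
  proof eventually_elim
    case (elim n)
    then obtain w where w: "w \<in> W n" "f w \<le> C * s ^ n" by blast
    have "root n (f w) \<le> root n (C * s ^ n)" using w elim by simp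
    also have "\<dots> = root n C * s" using elim s0 by (simp add: real_root_mult real_root_power_cancel)
    finally have "root n (f w) < a" using elim by simp
    with w fin show ?case by (auto simp: Min_less_iff)
  qed
qed

section \<open>The radius of a pair in polar coordinates\<close>

locale rank_one_rotation =
  fixes P J :: mat2 and r \<theta> :: real
  assumes det_P: "det P = 0" and trace_P: "trace P \<noteq> 0"
    and J: "J ** J = - mat 1" and r: "r > 0" and \<theta>: "0 < \<theta>" "\<theta> < pi"
begin

abbreviation "A \<equiv> (P, rot r \<theta> J)"
abbreviation "B \<equiv> rot r \<theta> J"

lemma in_PP_EE: "A \<in> PP \<times> EE"
  using det_P trace_P rot_in_EE[OF J r \<theta>] by (simp add: PP_iff)

lemma trace_seq_eq: "trace_seq A n = r ^ n * (trace P * cos (n * \<theta>) + trace (P ** J) * sin (n * \<theta>))"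
  by (simp add: trace_seq_def mat_power_rot[OF J] trace_mult_rot)

lemma sqrt_det_B: "sqrt (det B) = r"
  using r by (simp add: det_rot[OF J])

lemma rates_eq: "rates A = insert r (range (\<lambda>k. root (Suc k) \<bar>trace_seq A k\<bar>))"
  by (simp add: rates_def sqrt_det_B)

lemma rates_nonneg: "s \<in> rates A \<Longrightarrow> s \<ge> 0"
  unfolding rates_eq using r by auto

lemma rates_bdd_below: "bdd_below (rates A)"
  using rates_nonneg by (meson bdd_below.I)

lemma rates_nonempty: "rates A \<noteq> {}"
  by (simp add: rates_eq)

abbreviation "rate \<equiv> Inf (rates A)"

lemma rate_nonneg: "rate \<ge> 0"
  by (intro cInf_greatest rates_nonempty rates_nonneg)

lemma rate_le: "rate \<le> r"
  by (intro cInf_lower rates_bdd_below) (simp add: rates_eq)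

lemma rate_le_trace_seq: "rate ^ Suc k \<le> \<bar>trace_seq A k\<bar>"
proof -
  have "rate \<le> root (Suc k) \<bar>trace_seq A k\<bar>"
    by (intro cInf_lower rates_bdd_below) (simp add: rates_eq)
  then have "rate ^ Suc k \<le> root (Suc k) \<bar>trace_seq A k\<bar> ^ Suc k"
    using rate_nonneg by (intro power_mono)
  then show ?thesis by (simp only: real_root_pow_pos2 zero_less_Suc abs_ge_zero)
qed

lemma sandwich: "P ** mat_power B k ** P = trace_seq A k *\<^sub>R P"
  using rank_one_sandwich[OF det_P] by (simp add: trace_seq_def)

text \<open>Prepares inductions over words. The factor B^k P on the right records a run of k letters
  2 following a P. A further 2 lengthens the run; a 1 turns it into the scalar t_k and restarts with
  the empty run.\<close>

lemma word_sandwich: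
  "word_prod A (i # w) ** mat_power B k ** P =
    (if i = 1 then trace_seq A k *\<^sub>R (word_prod A w ** mat_power B 0 ** P)
     else word_prod A w ** mat_power B (Suc k) ** P)"
  using arg_cong[OF sandwich[of k], of "\<lambda>X. word_prod A w ** X"]
  by (simp add: letter_def mat2_mult_scaleR matrix_mul_assoc)

lemma norm_rot: "norm (rot x \<phi> J) \<le> \<bar>x\<bar> * (norm (mat 1 :: mat2) + norm J)"
proof -
  have "norm (rot x \<phi> J) \<le> \<bar>x * cos \<phi>\<bar> * norm (mat 1 :: mat2) + \<bar>x * sin \<phi>\<bar> * norm J"
    unfolding rot_def by (rule norm_triangle_le) simp
  also have "\<dots> \<le> \<bar>x\<bar> * norm (mat 1 :: mat2) + \<bar>x\<bar> * norm J"
    by (intro add_mono mult_right_mono) (auto simp: abs_mult mult_left_le)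
  finally show ?thesis by (simp add: algebra_simps)
qed

text \<open>Every completed run contributes a factor |t_k|, which is at least rate^(k+1). Only the
  last, unfinished run is estimated by norms, so the constant is independent of the word.\<close>

lemma norm_word_sandwich_ge: "\<exists>c>0. \<forall>w k. c * rate ^ (length w + k) \<le> norm (word_prod A w ** mat_power B k ** P)"
proof -
  obtain K where K: "K > 0" "\<And>(X :: mat2) (Y :: mat2). norm (X ** Y) \<le> K * norm X * norm Y"
    using mat2_mult_norm_bound by blast
  define L where "L = norm (mat 1 :: mat2) + norm J"
  have L: "L > 0" unfolding L_def by (rule add_pos_nonneg) (auto simp: mat2_eq_iff mat2_one_nth)
  have P0: "norm P > 0" using trace_P by (auto simp: trace_2)
  define c where "c = norm P / (K * L)"
  have c: "c > 0" using K L P0 by (simp add: c_def)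
  have "c * rate ^ (length w + k) \<le> norm (word_prod A w ** mat_power B k ** P)" for w k
  proof (induction w arbitrary: k)
    case Nil
    \<comment> \<open>The inverse of B^k has norm at most L / r^k; cancelling B^k therefore bounds
      B^k P from below by a multiple of r^k.\<close>
    have "rot (1 / r ^ k) (- (k * \<theta>)) J ** rot (r ^ k) (k * \<theta>) J = mat 1"
      using r by (simp add: rot_mult[OF J]) (simp add: rot_def)
    then have "P = rot (1 / r ^ k) (- (k * \<theta>)) J ** (mat_power B k ** P)"
      by (simp add: mat_power_rot[OF J] matrix_mul_assoc)
    then have "norm P \<le> K * norm (rot (1 / r ^ k) (- (k * \<theta>)) J) * norm (mat_power B k ** P)"
      using K(2) by metis
    also have "\<dots> \<le> K * (L / r ^ k) * norm (mat_power B k ** P)"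
      using norm_rot[of "1 / r ^ k" "- (k * \<theta>)"] r K(1)
      by (intro mult_right_mono mult_left_mono) (auto simp: L_def)
    finally have "c * r ^ k \<le> norm (mat_power B k ** P)"
      using K L r by (simp add: c_def field_simps)
    moreover have "c * rate ^ k \<le> c * r ^ k"
      using c rate_nonneg rate_le by (intro mult_left_mono power_mono) auto
    ultimately show ?case by simp
  next
    case (Cons i w)
    show ?case
    proof (cases "i = 1")
      case True
      have "c * rate ^ (length (i # w) + k) = rate ^ Suc k * (c * rate ^ (length w + 0))"
        by (simp add: power_add)
      also have "\<dots> \<le> \<bar>trace_seq A k\<bar> * norm (word_prod A w ** mat_power B 0 ** P)"
        by (intro mult_mono rate_le_trace_seq Cons.IH) (use c rate_nonneg in auto)
      finally show ?thesis using True by (simp only: word_sandwich refl if_True norm_scaleR)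
    next
      case False
      then show ?thesis using Cons.IH[of "Suc k"] by (simp only: word_sandwich if_False list.size add_Suc_right add_Suc plus_nat.add_Suc add_0_right)
    qed
  qed
  with c show ?thesis by blast
qed

lemma norm_word_prod_ge: "\<exists>c>0. \<forall>n. \<forall>w\<in>words n. c * rate ^ n \<le> norm (word_prod A w)"
proof -
  obtain K where K: "K > 0" "\<And>(X :: mat2) (Y :: mat2). norm (X ** Y) \<le> K * norm X * norm Y"
    using mat2_mult_norm_bound by blast
  obtain c where c: "c > 0" "\<And>w k. c * rate ^ (length w + k) \<le> norm (word_prod A w ** mat_power B k ** P)"
    using norm_word_sandwich_ge by blast
  have P0: "norm P > 0" using trace_P by (auto simp: trace_2)
  have "c / (K * norm P) * rate ^ n \<le> norm (word_prod A w)" if "w \<in> words n" for n w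
  proof -
    have "c * rate ^ n \<le> norm (word_prod A w ** P)"
      using c(2)[of w 0] that by (simp add: words_def)
    also have "\<dots> \<le> K * norm (word_prod A w) * norm P" by (rule K)
    finally show ?thesis using K P0 by (simp add: field_simps)
  qed
  moreover have "c / (K * norm P) > 0" using c K P0 by simp
  ultimately show ?thesis by blast
qed

lemma word_prod_block:
  "word_prod A (concat (replicate (Suc j) (replicate k 2 @ [1]))) = trace_seq A k ^ j *\<^sub>R (P ** mat_power B k)"
proof (induction j)
  case 0
  then show ?case by (simp add: word_prod_append word_prod_replicate_2 letter_def)
next
  case (Suc j)
  have "P ** mat_power B k ** (P ** mat_power B k) = trace_seq A k *\<^sub>R (P ** mat_power B k)"
    by (simp only: matrix_mul_assoc sandwich mat2_mult_scaleR)
  with Suc show ?case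
    unfolding replicate_Suc[of "Suc j"] concat.simps word_prod_append[of _ _ "concat _"]
    by (simp add: word_prod_append word_prod_replicate_2 letter_def mat2_mult_scaleR matrix_mul_assoc)
qed

lemma block_words_small:
  assumes s: "s = root (Suc k) \<bar>trace_seq A k\<bar>"
  shows "\<exists>C>0. \<forall>\<^sub>F n in sequentially. \<exists>w\<in>words n. norm (word_prod A w) \<le> C * s ^ n"
proof -
  define K where "K = (\<Sum>i\<le>k. norm (mat_power B i ** (P ** mat_power B k)))"
  have K: "K \<ge> 0" by (simp add: K_def sum_nonneg)
  have s0: "s \<ge> 0" by (simp add: s)
  have ts: "\<bar>trace_seq A k\<bar> = s ^ Suc k"
    unfolding s by (simp only: real_root_pow_pos2 zero_less_Suc abs_ge_zero)
  \<comment> \<open>The periodic part of the word yields only s^(Suc k * Suc j), and n exceeds that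
    exponent by Suc k + i < 2 * Suc k. \<open>D\<close> pays for these missing factors of s; the
    base 1 + 1 / s is at least 1, also for s = 0, where 1 / s is 0.\<close>
  define D where "D = (1 + 1 / s) ^ (2 * Suc k)"
  have D: "D \<ge> 1" using s0 unfolding D_def by (intro one_le_power) simp
  have "\<exists>w\<in>words n. norm (word_prod A w) \<le> ((K + 1) * D) * s ^ n" if n: "n \<ge> 2 * Suc k" for n
  proof -
    \<comment> \<open>Of the j + 2 blocks one remains as P B^k, so t_k occurs to the power j + 1.
      This exponent is positive, which makes the product vanish when t_k = 0; hence n has to reach 2
      * Suc k.\<close>
    define j where "j = n div Suc k - 2"
    define i where "i = n mod Suc k"
    have ik: "i \<le> k" unfolding i_def by (metis less_Suc_eq_le mod_less_divisor zero_less_Suc)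
    have "n div Suc k \<ge> 2" using n by (metis div_le_mono nonzero_mult_div_cancel_right zero_less_Suc less_irrefl)
    then have dj: "n div Suc k = Suc (Suc j)" by (simp add: j_def)
    have nd: "n = Suc k * Suc (Suc j) + i" unfolding i_def dj[symmetric] by (rule mult_div_mod_eq[symmetric])
    let ?w = "concat (replicate (Suc (Suc j)) (replicate k 2 @ [1])) @ replicate i 2"
    have len: "length (concat (replicate m (replicate k (2::nat) @ [1]))) = m * Suc k" for m
      by (induction m) auto
    have st: "set (concat (replicate m (replicate k (2::nat) @ [1]))) \<subseteq> {1, 2}" for m
      by (induction m) auto
    have w: "?w \<in> words n"
      unfolding words_def mem_Collect_eq length_append set_append len using nd st[of "Suc (Suc j)"]
      by (auto simp only: length_replicate mult.commute set_replicate_conv_if split: if_splits)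
    have "norm (word_prod A ?w) = \<bar>trace_seq A k\<bar> ^ Suc j * norm (mat_power B i ** (P ** mat_power B k))"
      unfolding word_prod_append[of A "concat _"] word_prod_block word_prod_replicate_2
      by (simp add: mat2_mult_scaleR power_abs abs_mult)
    also have "\<dots> \<le> \<bar>trace_seq A k\<bar> ^ Suc j * K"
      unfolding K_def using ik by (intro mult_left_mono member_le_sum) auto
    also have "\<bar>trace_seq A k\<bar> ^ Suc j = s ^ (Suc k * Suc j)" unfolding ts by (simp only: power_mult)
    also have "s ^ (Suc k * Suc j) \<le> D * s ^ n"
    proof (cases "s = 0")
      case False
      then have sp: "s > 0" using s0 by simp
      have "s ^ n = s ^ (Suc k * Suc j) * s ^ (Suc k + i)" unfolding nd by (simp add: power_add[symmetric] algebra_simps)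
      moreover have "1 \<le> D * s ^ (Suc k + i)"
      proof -
        have "(1 / s) ^ (Suc k + i) \<le> (1 + 1 / s) ^ (Suc k + i)"
          using sp by (intro power_mono) auto
        also have "\<dots> \<le> D" unfolding D_def using sp ik by (intro power_increasing) auto
        finally show ?thesis using sp by (simp add: field_simps power_divide del: power_Suc)
      qed
      then have "s ^ (Suc k * Suc j) * 1 \<le> s ^ (Suc k * Suc j) * (D * s ^ (Suc k + i))"
        using sp by (intro mult_left_mono) auto
      ultimately show ?thesis by (simp only: mult.left_commute mult.assoc mult_1_right)
    qed (use D in auto)
    then have "s ^ (Suc k * Suc j) * K \<le> D * s ^ n * (K + 1)"
      using K s0 D by (intro mult_mono) auto
    finally have "norm (word_prod A ?w) \<le> ((K + 1) * D) * s ^ n"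
      by (simp only: mult.commute mult.left_commute)
    with w show ?thesis by blast
  qed
  then have "\<forall>\<^sub>F n in sequentially. \<exists>w\<in>words n. norm (word_prod A w) \<le> ((K + 1) * D) * s ^ n"
    by (auto simp: eventually_sequentially)
  moreover have "(K + 1) * D > 0" using K D by simp
  ultimately show ?thesis by blast
qed

lemma power_words_small:
  "\<exists>C>0. \<forall>\<^sub>F n in sequentially. \<exists>w\<in>words n. norm (word_prod A w) \<le> C * r ^ n"
proof -
  let ?C = "norm (mat 1 :: mat2) + norm J"
  have "replicate n 2 \<in> words n" for n by (auto simp: words_def)
  moreover have "norm (word_prod A (replicate n 2)) \<le> ?C * r ^ n" for n
    using norm_rot[of "r ^ n" "n * \<theta>"] r by (simp add: word_prod_replicate_2 mat_power_rot[OF J] algebra_simps)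
  moreover have "?C > 0" by (rule add_pos_nonneg) (auto simp: mat2_eq_iff mat2_one_nth)
  ultimately show ?thesis by (metis (mono_tags, lifting) always_eventually)
qed

theorem lower_spectral_radius_eq: "lower_spectral_radius A = rate"
proof -
  obtain c where c: "c > 0" "\<And>n w. w \<in> words n \<Longrightarrow> c * rate ^ n \<le> norm (word_prod A w)"
    using norm_word_prod_ge by blast
  have "(\<lambda>n. Min ((\<lambda>w. root n (norm (word_prod A w))) ` words n)) \<longlonglongrightarrow> rate"
    by (rule Min_root_tendsto[where f = "\<lambda>w. norm (word_prod A w)", OF words_finite words_nonempty c(1) rates_nonempty rates_bdd_below rate_nonneg c(2)])
       (auto simp: rates_eq block_words_small power_words_small)
  then show ?thesis unfolding lower_spectral_radius_def by (rule limI)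
qed

text \<open>The counterpart of \<open>norm_word_sandwich_ge\<close> for traces, in which no constant
  is lost: such a trace is exactly a product of numbers t_k, so strict inequality for each factor
  passes to the whole word.\<close>

lemma trace_word_gt:
  assumes "\<And>k. rate ^ Suc k < \<bar>trace_seq A k\<bar>"
  shows "rate ^ (Suc (length w) + k) < \<bar>trace (word_prod A w ** mat_power B k ** P)\<bar>"
proof (induction w arbitrary: k)
  case Nil
  then show ?case using assms[of k] by (simp add: trace_seq_def trace_mul_sym[of P])
next
  case (Cons i w)
  show ?case
  proof (cases "i = 1")
    case True
    have "rate ^ (Suc (length (i # w)) + k) = rate ^ Suc k * rate ^ (Suc (length w) + 0)"
      by (simp add: power_add)
    also have "\<dots> < \<bar>trace_seq A k\<bar> * \<bar>trace (word_prod A w ** mat_power B 0 ** P)\<bar>"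
      by (intro mult_strict_mono' assms Cons.IH) (use rate_nonneg in auto)
    finally show ?thesis using True by (simp only: word_sandwich refl if_True trace_scaleR abs_mult)
  next
    case False
    then show ?thesis using Cons.IH[of "Suc k"] by (simp only: word_sandwich if_False list.size add_Suc_right add_Suc plus_nat.add_Suc add_0_right)
  qed
qed

lemma det_word_prod: "1 \<in> set w \<Longrightarrow> det (word_prod A w) = 0"
  by (induction w) (auto simp: det_mul letter_def det_P)

theorem lower_finiteness_property_iff:
  "lower_finiteness_property A \<longleftrightarrow> rate = r \<or> (\<exists>k. \<bar>trace_seq A k\<bar> = rate ^ Suc k)"
proof
  assume "lower_finiteness_property A"
  then obtain n w where n: "n \<ge> 1" and w: "w \<in> words n" and eq: "rate = root n (spectral_radius (word_prod A w))"
    unfolding lower_finiteness_property_def lower_spectral_radius_eq by blast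
  show "rate = r \<or> (\<exists>k. \<bar>trace_seq A k\<bar> = rate ^ Suc k)"
  proof (cases "1 \<in> set w")
    case False
    have "word_prod A w = rot (r ^ n) (n * \<theta>) J"
      using word_prod_no_1[of w A] w False by (simp add: words_def mat_power_rot[OF J])
    moreover have "(r ^ n * cos (n * \<theta>))\<^sup>2 \<le> (r ^ n)\<^sup>2 * 1"
      unfolding power_mult_distrib by (intro mult_left_mono) (auto simp: abs_square_le_1)
    ultimately have "spectral_radius (word_prod A w) = r ^ n"
      using r by (subst spectral_radius_nonreal) (auto simp: trace_rot[OF J] det_rot[OF J] power_mult_distrib)
    then show ?thesis using eq n r by (simp add: real_root_power_cancel)
  next
    case True
    then obtain x y where xy: "w = x @ 1 # y" by (meson split_list)
    have sr: "spectral_radius (word_prod A w) = \<bar>trace (word_prod A w)\<bar>"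
      by (intro spectral_radius_det_0 det_word_prod True)
    \<comment> \<open>The trace is cyclic, so one occurrence of P can be moved to the right end; the
      word then has the shape of \<open>trace_word_gt\<close> with an empty run.\<close>
    have "trace (word_prod A w) = trace (word_prod A y ** P ** word_prod A x)"
      by (simp add: xy word_prod_append letter_def)
    also have "\<dots> = trace (word_prod A x ** (word_prod A y ** P))"
      by (rule trace_mul_sym)
    also have "\<dots> = trace (word_prod A (y @ x) ** mat_power B 0 ** P)"
      by (simp add: word_prod_append matrix_mul_assoc)
    finally have tr: "trace (word_prod A w) = trace (word_prod A (y @ x) ** mat_power B 0 ** P)" .
    have len: "Suc (length (y @ x)) = n" using w by (simp add: words_def xy)
    have "rate ^ n = spectral_radius (word_prod A w)"
      unfolding eq using n sr by (subst real_root_pow_pos2) auto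
    then have "\<not> (\<forall>k. rate ^ Suc k < \<bar>trace_seq A k\<bar>)"
      using trace_word_gt[of "y @ x" 0] unfolding sr tr len by auto
    then show ?thesis using rate_le_trace_seq by (meson not_less order_antisym)
  qed
next
  assume "rate = r \<or> (\<exists>k. \<bar>trace_seq A k\<bar> = rate ^ Suc k)"
  then show "lower_finiteness_property A"
  proof
    assume *: "rate = r"
    have "spectral_radius (word_prod A [2]) = r"
      using \<theta> r by (subst spectral_radius_nonreal)
        (auto simp: trace_rot[OF J] det_rot[OF J] letter_def power_mult_distrib abs_square_le_1)
    moreover have "[2] \<in> words 1" by (simp add: words_def)
    ultimately show ?thesis unfolding lower_finiteness_property_def lower_spectral_radius_eq *
      by (intro exI[of _ 1] conjI bexI[of _ "[2]"]) auto
  next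
    assume "\<exists>k. \<bar>trace_seq A k\<bar> = rate ^ Suc k"
    then obtain k where k: "\<bar>trace_seq A k\<bar> = rate ^ Suc k" by blast
    let ?w = "replicate k 2 @ [1]"
    have "spectral_radius (word_prod A ?w) = \<bar>trace_seq A k\<bar>"
      by (subst spectral_radius_det_0)
        (auto simp: det_word_prod word_prod_append word_prod_replicate_2 letter_def trace_seq_def det_mul det_P)
    moreover have "?w \<in> words (Suc k)" by (auto simp: words_def)
    moreover have "rate = root (Suc k) (rate ^ Suc k)"
      by (rule real_root_power_cancel[symmetric]) (auto simp: rate_nonneg)
    ultimately show ?thesis unfolding lower_finiteness_property_def lower_spectral_radius_eq
      by (intro exI[of _ "Suc k"] conjI bexI[of _ ?w]) (auto simp: k simp del: power_Suc)
  qed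
qed

end

section \<open>Trigonometric waves\<close>

text \<open>For |u| <= 2 the Taylor remainder |u|^3 / 6 is at most 2 |u| / 3. The radius 2 exceeds
  pi / 2, so a whole period of |sin| around its zero is covered.\<close>

lemma abs_sin_ge_third:
  fixes u :: real
  assumes "\<bar>u\<bar> \<le> 2"
  shows "\<bar>u\<bar> / 3 \<le> \<bar>sin u\<bar>"
proof -
  have "\<bar>sin u - (\<Sum>m<3. sin_coeff m * u ^ m)\<bar> \<le> inverse (fact 3) * \<bar>u\<bar> ^ 3"
    by (rule Maclaurin_sin_bound)
  then have "\<bar>sin u - u\<bar> \<le> \<bar>u\<bar> ^ 3 / 6"
    by (simp add: sin_coeff_def numeral_3_eq_3 lessThan_Suc)
  also have "\<bar>u\<bar> ^ 3 = \<bar>u\<bar> * \<bar>u\<bar>\<^sup>2" by (simp add: power2_eq_square power3_eq_cube)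
  also have "\<bar>u\<bar>\<^sup>2 \<le> 2\<^sup>2" using assms by (intro power_mono) auto
  finally have "\<bar>sin u - u\<bar> \<le> \<bar>u\<bar> * 2\<^sup>2 / 6" by (simp add: mult_left_mono)
  then show ?thesis by (simp add: abs_if split: if_splits)
qed

lemma abs_cos_less_near_zero:
  fixes y :: real
  assumes "\<bar>cos y\<bar> < \<delta>"
  obtains m :: int where "\<bar>y - pi / 2 - m * pi\<bar> \<le> 3 * \<delta>"
proof -
  \<comment> \<open>On [m pi, (m + 1) pi) the zero of the cosine is the midpoint, so
    \<open>u\<close> has absolute value at most pi / 2 < 2.\<close>
  define m where "m = \<lfloor>y / pi\<rfloor>"
  define u where "u = y - pi / 2 - m * pi"
  have "of_int m \<le> y / pi" "y / pi < of_int m + 1" unfolding m_def by linarith+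
  then have "m * pi \<le> y" "y < m * pi + pi" by (simp_all add: field_simps)
  then have "\<bar>u\<bar> \<le> 2" unfolding u_def using pi_less_4 by auto
  have "y = u + pi / 2 + m * pi" by (simp add: u_def)
  then have "cos y = - sin u * cos (m * pi) - cos u * sin (m * pi)"
    by (simp add: cos_add sin_add)
  moreover have "sin (m * pi) = 0" "\<bar>cos (m * pi)\<bar> = 1"
    using sin_npi_int[of m] cos_npi_int[of m] by (simp_all add: mult.commute)
  ultimately have "\<bar>cos y\<bar> = \<bar>sin u\<bar>" by (simp add: abs_mult)
  with abs_sin_ge_third[OF \<open>\<bar>u\<bar> \<le> 2\<close>] assms have "\<bar>u\<bar> \<le> 3 * \<delta>" by simp
  then show ?thesis using that u_def by blast
qed

lemma borel_subset_interval_fmeasurable: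
  fixes S :: "real set"
  assumes "S \<in> sets borel" "S \<subseteq> {a..b}"
  shows "S \<in> lmeasurable"
  by (rule fmeasurableI2[of "{a..b}"]) (use assms in auto)

text \<open>For \<delta> <= 1 the set is covered by intervals of length 6 \<delta> / n around zeros,
  and at most n (v - u) + 3 zeros are involved, whence 18 = 3 * 6. The term 1 / n is the cost of the
  endpoints and dominates when the interval is shorter than a period. For \<delta> > 1 the length of
  the interval is already a sufficient bound.\<close>

lemma measure_abs_cos_less:
  fixes u v \<delta> \<phi> :: real and n :: nat
  assumes "u \<le> v" "n \<ge> 1" "\<delta> \<ge> 0"
  shows "measure lebesgue {\<theta>::real \<in> {u..v}. \<bar>cos (n * \<theta> - \<phi>)\<bar> < \<delta>} \<le> 18 * \<delta> * (v - u + 1 / n)"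
proof (cases "\<delta> \<le> 1")
  case False
  have "measure lebesgue {\<theta>::real \<in> {u..v}. \<bar>cos (n * \<theta> - \<phi>)\<bar> < \<delta>} \<le> measure lebesgue {u..v}"
    by (rule measure_mono_fmeasurable[OF _ fmeasurableD[OF borel_subset_interval_fmeasurable[of _ u v]]]) auto
  also have "\<dots> = 1 * (v - u)" using assms by simp
  also have "\<dots> \<le> (18 * \<delta>) * (v - u + 1 / n)"
    using assms False by (intro mult_mono) auto
  finally show ?thesis .
next
  case True
  define c where "c = \<phi> + pi / 2"
  define z where "z m = (c + m * pi) / n" for m :: int
  define S where "S = {\<lceil>(n * u - c - 3 * \<delta>) / pi\<rceil>..\<lfloor>(n * v - c + 3 * \<delta>) / pi\<rfloor>}"
  have sub: "{\<theta>::real \<in> {u..v}. \<bar>cos (n * \<theta> - \<phi>)\<bar> < \<delta>} \<subseteq> (\<Union>m\<in>S. {z m - 3 * \<delta> / n .. z m + 3 * \<delta> / n})"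
  proof
    fix \<theta> assume "\<theta> \<in> {\<theta>::real \<in> {u..v}. \<bar>cos (n * \<theta> - \<phi>)\<bar> < \<delta>}"
    then have th: "u \<le> \<theta>" "\<theta> \<le> v" "\<bar>cos (n * \<theta> - \<phi>)\<bar> < \<delta>" by auto
    from th(3) obtain m :: int where "\<bar>n * \<theta> - \<phi> - pi / 2 - m * pi\<bar> \<le> 3 * \<delta>"
      using abs_cos_less_near_zero by blast
    then have m: "\<bar>n * \<theta> - (c + m * pi)\<bar> \<le> 3 * \<delta>" by (simp add: c_def algebra_simps)
    have nn: "n * u \<le> n * \<theta>" "n * \<theta> \<le> n * v" using th by (auto intro: mult_left_mono)
    have "(n * u - c - 3 * \<delta>) \<le> m * pi" "m * pi \<le> (n * v - c + 3 * \<delta>)"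
      using m nn unfolding abs_le_iff by linarith+
    then have "m \<in> S" unfolding S_def by (auto simp: ceiling_le_iff le_floor_iff field_simps)
    moreover have "\<theta> \<in> {z m - 3 * \<delta> / n .. z m + 3 * \<delta> / n}"
    proof -
      have "n * z m = c + m * pi" using assms(2) by (simp add: z_def)
      then have "n * \<theta> - (c + m * pi) = n * (\<theta> - z m)" by (simp only: right_diff_distrib)
      then have "\<bar>n * \<theta> - (c + m * pi)\<bar> = n * \<bar>\<theta> - z m\<bar>" by (simp only: abs_mult abs_of_nat)
      with m have "n * \<bar>\<theta> - z m\<bar> \<le> 3 * \<delta>" by simp
      then have "\<bar>\<theta> - z m\<bar> \<le> 3 * \<delta> / n" using assms(2) by (subst pos_le_divide_eq) (auto simp: mult.commute)
      then show ?thesis by (simp add: abs_le_iff algebra_simps)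
    qed
    ultimately show "\<theta> \<in> (\<Union>m\<in>S. {z m - 3 * \<delta> / n .. z m + 3 * \<delta> / n})" by blast
  qed
  have fin: "finite S" by (simp add: S_def)
  have card: "real (card S) \<le> n * (v - u) + 3"
  proof -
    have "real (card S) = real (nat (\<lfloor>(n * v - c + 3 * \<delta>) / pi\<rfloor> + 1 - \<lceil>(n * u - c - 3 * \<delta>) / pi\<rceil>))"
      by (simp add: S_def)
    also have "\<dots> \<le> max 0 ((n * v - c + 3 * \<delta>) / pi + 1 - (n * u - c - 3 * \<delta>) / pi)"
      by linarith
    also have "(n * v - c + 3 * \<delta>) / pi + 1 - (n * u - c - 3 * \<delta>) / pi = (n * (v - u) + 6 * \<delta>) / pi + 1"
      by (simp add: field_simps)
    also have "\<dots> \<le> (n * (v - u) + 6 * \<delta>) / 3 + 1"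
      using assms pi_gt3 by (intro add_mono divide_left_mono) auto
    also have "(n * (v - u) + 6 * \<delta>) / 3 + 1 \<le> n * (v - u) + 3"
    proof -
      have "0 \<le> n * (v - u)" using assms(1) by simp
      then show ?thesis using True by (simp only: add_divide_distrib)
    qed
    finally show ?thesis using assms by simp
  qed
  have "measure lebesgue {\<theta>::real \<in> {u..v}. \<bar>cos (n * \<theta> - \<phi>)\<bar> < \<delta>}
      \<le> measure lebesgue (\<Union>m\<in>S. {z m - 3 * \<delta> / n .. z m + 3 * \<delta> / n})"
    by (rule measure_mono_fmeasurable[OF sub fmeasurableD[OF borel_subset_interval_fmeasurable[of _ u v]]])
      (auto intro!: fmeasurable.finite_UN fin)
  also have "\<dots> \<le> (\<Sum>m\<in>S. measure lebesgue {z m - 3 * \<delta> / n .. z m + 3 * \<delta> / n})"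
    by (rule measure_UNION_le) (auto simp: fin)
  also have "\<dots> = real (card S) * (6 * \<delta> / n)"
    using assms by (simp add: field_simps)
  also have "\<dots> \<le> (n * (v - u) + 3) * (6 * \<delta> / n)"
    using assms card by (intro mult_right_mono) auto
  also have "\<dots> = 6 * (\<delta> * (v - u)) + 18 * \<delta> * (1 / n)"
    using assms by (simp add: field_simps)
  also have "\<dots> \<le> 18 * (\<delta> * (v - u)) + 18 * \<delta> * (1 / n)"
    using assms by (intro add_right_mono mult_right_mono) auto
  also have "\<dots> = 18 * \<delta> * (v - u + 1 / n)" by (simp add: algebra_simps)
  finally show ?thesis .
qed

section \<open>Waves, their zeros and generic angles\<close>

definition wave :: "real \<Rightarrow> real \<Rightarrow> nat \<Rightarrow> real \<Rightarrow> real" where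
  "wave p q n \<theta> = p * cos (n * \<theta>) + q * sin (n * \<theta>)"

text \<open>The amplitude is the modulus of p + i q. Bounding it below by |p| lets the later
  estimates depend on p = tr P alone, which is nonzero on \<open>PP\<close>.\<close>

lemma wave_polar:
  obtains R \<phi> where "R \<ge> \<bar>p\<bar>" "\<And>n \<theta>. wave p q n \<theta> = R * cos (n * \<theta> - \<phi>)"
proof -
  define z where "z = Complex p q"
  have z: "z = rcis (cmod z) (Arg z)" by (simp add: rcis_cmod_Arg)
  have pq: "p = cmod z * cos (Arg z)" "q = cmod z * sin (Arg z)"
    using arg_cong[OF z, of Re] arg_cong[OF z, of Im] by (simp_all add: z_def)
  have "\<bar>p\<bar> \<le> cmod z" using abs_Re_le_cmod[of z] by (simp add: z_def)
  moreover have "wave p q n \<theta> = cmod z * cos (n * \<theta> - Arg z)" for n \<theta>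
    unfolding wave_def cos_diff by (subst pq(1), subst pq(2)) (simp add: algebra_simps)
  ultimately show ?thesis using that by blast
qed

lemma continuous_on_wave [continuous_intros]:
  fixes f :: "'a::t2_space \<Rightarrow> real"
  shows "continuous_on S f \<Longrightarrow> continuous_on S (\<lambda>x. wave p q n (f x))"
  unfolding wave_def by (intro continuous_intros)

lemma borel_measurable_wave [measurable]: "wave p q n \<in> borel_measurable borel"
  by (intro borel_measurable_continuous_onI continuous_intros)

lemma wave_lipschitz:
  obtains L where "L > 0" "\<And>n x y. \<bar>wave p q n x - wave p q n y\<bar> \<le> L * n * \<bar>x - y\<bar>"
proof -
  obtain R \<phi> where R: "R \<ge> \<bar>p\<bar>" "\<And>n \<theta>. wave p q n \<theta> = R * cos (n * \<theta> - \<phi>)"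
    using wave_polar by blast
  have "\<bar>wave p q n x - wave p q n y\<bar> \<le> (R + 1) * n * \<bar>x - y\<bar>" for n x y
  proof -
    have "\<bar>cos a - cos b\<bar> \<le> \<bar>a - b\<bar>" for a b :: real
    proof -
      have "\<bar>cos a - cos b\<bar> = 2 * \<bar>sin ((a + b) / 2)\<bar> * \<bar>sin ((b - a) / 2)\<bar>"
        by (simp add: cos_diff_cos abs_mult)
      also have "\<dots> \<le> 2 * 1 * \<bar>(b - a) / 2\<bar>"
        by (intro mult_mono abs_sin_le_one abs_sin_x_le_abs_x) auto
      finally show ?thesis by simp
    qed
    from this[of "n * x - \<phi>" "n * y - \<phi>"]
    have "\<bar>cos (n * x - \<phi>) - cos (n * y - \<phi>)\<bar> \<le> n * \<bar>x - y\<bar>"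
      by (simp add: right_diff_distrib[symmetric] abs_mult)
    moreover have "\<bar>wave p q n x - wave p q n y\<bar> = R * \<bar>cos (n * x - \<phi>) - cos (n * y - \<phi>)\<bar>"
      using R by (simp add: right_diff_distrib[symmetric] abs_mult)
    ultimately have "\<bar>wave p q n x - wave p q n y\<bar> \<le> R * (n * \<bar>x - y\<bar>)"
      using R(1) by (simp add: mult_left_mono)
    also have "\<dots> \<le> (R + 1) * (n * \<bar>x - y\<bar>)" by (intro mult_right_mono) auto
    finally show ?thesis by (simp add: mult.assoc)
  qed
  moreover have "R + 1 > 0" using R(1) by linarith
  ultimately show ?thesis using that by blast
qed

lemma measure_abs_wave_less:
  assumes "p \<noteq> 0" "u \<le> v" "n \<ge> 1" "\<delta> \<ge> 0"
  shows "measure lebesgue {\<theta>::real \<in> {u..v}. \<bar>wave p q n \<theta>\<bar> < \<delta>} \<le> 18 * (\<delta> / \<bar>p\<bar>) * (v - u + 1 / n)"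
proof -
  obtain R \<phi> where R: "R \<ge> \<bar>p\<bar>" "\<And>n \<theta>. wave p q n \<theta> = R * cos (n * \<theta> - \<phi>)"
    using wave_polar by blast
  have R0: "R > 0" using R(1) assms(1) by linarith
  have "{\<theta>::real \<in> {u..v}. \<bar>wave p q n \<theta>\<bar> < \<delta>} = {\<theta>::real \<in> {u..v}. \<bar>cos (n * \<theta> - \<phi>)\<bar> < \<delta> / R}"
    using R0 by (auto simp: R(2) abs_mult field_simps)
  then have "measure lebesgue {\<theta>::real \<in> {u..v}. \<bar>wave p q n \<theta>\<bar> < \<delta>} \<le> 18 * (\<delta> / R) * (v - u + 1 / n)"
    using measure_abs_cos_less[of u v n "\<delta> / R" \<phi>] assms R0 by simp
  also have "\<dots> \<le> 18 * (\<delta> / \<bar>p\<bar>) * (v - u + 1 / n)"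
    using R assms by (intro mult_right_mono mult_left_mono divide_left_mono) auto
  finally show ?thesis .
qed

text \<open>Consecutive zeros of the n-th wave are pi / n apart, so n is taken with pi / n below the
  length of the interval.\<close>

lemma exists_wave_zero:
  assumes "s < t" shows "\<exists>n \<theta>. s < \<theta> \<and> \<theta> < t \<and> wave p q n \<theta> = 0"
proof -
  obtain R \<phi> where R: "\<And>n \<theta>. wave p q n \<theta> = R * cos (n * \<theta> - \<phi>)"
    using wave_polar by blast
  obtain n :: nat where n: "pi / (t - s) < n" using reals_Archimedean2 by blast
  have "0 < pi / (t - s)" using assms by simp
  then have n0: "real n > 0" using n by linarith
  have nts: "pi < n * (t - s)" using n assms by (simp add: field_simps)
  \<comment> \<open>The rounding selects the first zero strictly to the right of s, which lies at
    most pi / n beyond s.\<close>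
  define m where "m = \<lfloor>(n * s - \<phi> - pi / 2) / pi\<rfloor> + 1"
  define \<theta> where "\<theta> = (\<phi> + pi / 2 + m * pi) / n"
  have "(n * s - \<phi> - pi / 2) / pi < m" "m \<le> (n * s - \<phi> - pi / 2) / pi + 1"
    unfolding m_def by linarith+
  then have "n * s < \<phi> + pi / 2 + m * pi" "\<phi> + pi / 2 + m * pi \<le> n * s + pi"
    by (simp_all add: field_simps)
  moreover have "n * \<theta> = \<phi> + pi / 2 + m * pi" using n0 by (simp add: \<theta>_def)
  ultimately have "n * s < n * \<theta>" "n * \<theta> < n * t"
    using nts by (simp_all add: right_diff_distrib)
  then have "s < \<theta>" "\<theta> < t" using n0 by auto
  moreover have "cos (n * \<theta> - \<phi>) = 0"
  proof -
    have "n * \<theta> - \<phi> = pi / 2 + m * pi" using n0 by (simp add: \<theta>_def)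
    then show ?thesis using sin_npi_int[of m] by (simp add: cos_add mult.commute)
  qed
  ultimately show ?thesis using R by auto
qed

definition wave_generic :: "real \<Rightarrow> real \<Rightarrow> real \<Rightarrow> bool" where
  "wave_generic p q \<theta> \<longleftrightarrow> (\<forall>n. wave p q n \<theta> \<noteq> 0) \<and> (\<forall>\<^sub>F n in sequentially. 1 / (real n)\<^sup>2 \<le> \<bar>wave p q n \<theta>\<bar>)"

text \<open>The zero set lies in every sublevel set, and the measure bound for those is linear in
  \<delta>. For n = 0 the wave is the constant p.\<close>

lemma negligible_wave_zeros:
  assumes "p \<noteq> 0" shows "negligible {\<theta>::real. wave p q n \<theta> = 0}"
proof (cases "n = 0")
  case False
  show ?thesis
  proof (subst negligible_on_intervals, intro allI)
    fix a b :: real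
    let ?Z = "{\<theta>::real. wave p q n \<theta> = 0} \<inter> cbox a b"
    have Z: "?Z \<in> lmeasurable" by (intro lmeasurable_compact closed_Int_compact closed_Collect_eq continuous_intros) auto
    show "negligible ?Z"
    proof (cases "a \<le> b")
      case True
      have "measure lebesgue ?Z \<le> 0"
      proof (rule field_le_epsilon)
        fix e :: real assume e: "0 < e"
        define c where "c = b - a + 1 / n"
        have pos: "c > 0" using True False by (simp add: c_def add_nonneg_pos)
        define \<delta> where "\<delta> = e * \<bar>p\<bar> / (18 * c)"
        have d: "\<delta> > 0" unfolding \<delta>_def using e pos assms by (intro divide_pos_pos mult_pos_pos) auto
        have "measure lebesgue ?Z \<le> measure lebesgue {\<theta>::real \<in> {a..b}. \<bar>wave p q n \<theta>\<bar> < \<delta>}"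
          using d by (intro measure_mono_fmeasurable fmeasurableD[OF Z] borel_subset_interval_fmeasurable[of _ a b]) auto
        also have "\<dots> \<le> 18 * (\<delta> / \<bar>p\<bar>) * (b - a + 1 / n)"
          using assms True False d by (intro measure_abs_wave_less) auto
        also have "\<dots> = e" unfolding c_def[symmetric] using pos assms by (simp add: \<delta>_def)
        finally show "measure lebesgue ?Z \<le> 0 + e" by simp
      qed
      then show ?thesis using Z by (simp add: negligible_iff_measure order_antisym)
    qed simp
  qed
qed (use assms in \<open>simp add: wave_def\<close>)

lemma negligible_not_wave_generic:
  assumes "p \<noteq> 0" shows "negligible {\<theta>. \<not> wave_generic p q \<theta>}"
proof (subst negligible_on_intervals, intro allI)
  fix a b :: real
  show "negligible ({\<theta>. \<not> wave_generic p q \<theta>} \<inter> cbox a b)"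
  proof (cases "a \<le> b")
    case True
    define E where "E n = {\<theta>::real \<in> {a..b}. \<bar>wave p q n \<theta>\<bar> < 1 / (real n)\<^sup>2}" for n :: nat
    have Es: "E n \<in> sets borel" for n unfolding E_def by measurable
    have fm: "E n \<in> lmeasurable" for n
      by (rule fmeasurableI2[of "{a..b}"]) (use Es[of n] in \<open>auto simp: E_def\<close>)
    have "summable (\<lambda>n. measure lebesgue (E n))"
    proof (rule summable_comparison_test_ev)
      show "\<forall>\<^sub>F n in sequentially. norm (measure lebesgue (E n)) \<le> 18 * (b - a + 1) / \<bar>p\<bar> * (1 / (real n)\<^sup>2)"
        using eventually_ge_at_top[of 1]
      proof eventually_elim
        case (elim n)
        have "measure lebesgue (E n) \<le> 18 * ((1 / (real n)\<^sup>2) / \<bar>p\<bar>) * (b - a + 1 / n)"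
          unfolding E_def using assms True elim by (intro measure_abs_wave_less) auto
        also have "\<dots> \<le> 18 * ((1 / (real n)\<^sup>2) / \<bar>p\<bar>) * (b - a + 1)"
          using elim by (intro mult_left_mono) (auto simp: field_simps)
        finally show ?case by (simp add: mult_ac)
      qed
      show "summable (\<lambda>n. 18 * (b - a + 1) / \<bar>p\<bar> * (1 / (real n)\<^sup>2))"
        by (intro summable_mult inverse_power_summable[of 2, simplified inverse_eq_divide]) simp
    qed
    then have "limsup E \<in> null_sets lebesgue"
      using fm unfolding fmeasurable_def by (intro borel_cantelli_limsup1) blast+
    then have "negligible (limsup E \<union> (\<Union>n. {\<theta>::real. wave p q n \<theta> = 0}))"
      using assms by (intro negligible_Un negligible_countable_Union) (auto simp: negligible_iff_null_sets[symmetric] negligible_wave_zeros)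
    moreover have "{\<theta>. \<not> wave_generic p q \<theta>} \<inter> cbox a b \<subseteq> limsup E \<union> (\<Union>n. {\<theta>::real. wave p q n \<theta> = 0})"
    proof
      fix \<theta> assume th: "\<theta> \<in> {\<theta>. \<not> wave_generic p q \<theta>} \<inter> cbox a b"
      show "\<theta> \<in> limsup E \<union> (\<Union>n. {\<theta>::real. wave p q n \<theta> = 0})"
      proof (cases "\<exists>n. wave p q n \<theta> = 0")
        case False
        then have "\<not> (\<forall>\<^sub>F n in sequentially. 1 / (real n)\<^sup>2 \<le> \<bar>wave p q n \<theta>\<bar>)"
          using th by (auto simp: wave_generic_def)
        then have "\<forall>k. \<exists>n\<ge>k. \<theta> \<in> E n"
          using th by (fastforce simp: E_def eventually_sequentially not_le)
        then show ?thesis by (auto simp: limsup_INF_SUP)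
      qed auto
    qed
    ultimately show ?thesis by (rule negligible_subset)
  qed simp
qed

lemma exists_wave_generic:
  assumes "p \<noteq> 0" "s < t" shows "\<exists>\<theta>. s < \<theta> \<and> \<theta> < t \<and> wave_generic p q \<theta>"
proof (rule ccontr)
  assume "\<not> ?thesis"
  then have "box s t \<subseteq> {\<theta>. \<not> wave_generic p q \<theta>}" by auto
  then have "negligible (box s t)" using negligible_not_wave_generic[OF assms(1)] negligible_subset by blast
  then show False using assms(2) using negligible_interval(2)[of s t] by simp
qed

section \<open>The rate as a function of the angle\<close>

definition wave_rates :: "real \<Rightarrow> real \<Rightarrow> real \<Rightarrow> real \<Rightarrow> real set" where
  "wave_rates p q r \<theta> = insert r (range (\<lambda>k. root (Suc k) \<bar>r ^ k * wave p q k \<theta>\<bar>))"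

abbreviation "wave_rate p q r \<theta> \<equiv> Inf (wave_rates p q r \<theta>)"

lemma wave_rates_nonneg: "r > 0 \<Longrightarrow> s \<in> wave_rates p q r \<theta> \<Longrightarrow> s \<ge> 0"
  unfolding wave_rates_def by auto

lemma wave_rates_bdd_below: "r > 0 \<Longrightarrow> bdd_below (wave_rates p q r \<theta>)"
  using wave_rates_nonneg by (meson bdd_below.I)

lemma wave_rates_nonempty: "wave_rates p q r \<theta> \<noteq> {}"
  by (simp add: wave_rates_def)

lemma wave_rate_nonneg: "r > 0 \<Longrightarrow> wave_rate p q r \<theta> \<ge> 0"
  by (intro cInf_greatest wave_rates_nonempty wave_rates_nonneg)

lemma wave_rate_le: "r > 0 \<Longrightarrow> wave_rate p q r \<theta> \<le> r"
  by (intro cInf_lower wave_rates_bdd_below) (simp_all add: wave_rates_def)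

lemma le_root_Suc_iff: "x \<ge> 0 \<Longrightarrow> x \<le> root (Suc k) \<bar>y\<bar> \<longleftrightarrow> x ^ Suc k \<le> \<bar>y\<bar>"
  by (metis real_root_le_iff real_root_power_cancel zero_less_Suc)

text \<open>Turns a superlevel condition on an infimum of roots into countably many closed
  conditions, one for each wave.\<close>

lemma le_wave_rate_iff:
  assumes "r > 0" "x \<ge> 0"
  shows "x \<le> wave_rate p q r \<theta> \<longleftrightarrow> x \<le> r \<and> (\<forall>k. x ^ Suc k \<le> \<bar>r ^ k * wave p q k \<theta>\<bar>)"
  unfolding le_cInf_iff[OF wave_rates_nonempty wave_rates_bdd_below[OF assms(1)]]
  unfolding wave_rates_def using assms(2) by (auto simp only: le_root_Suc_iff ball_simps image_iff insert_iff)

lemma wave_rate_eq_0: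
  assumes "r > 0" "wave p q n \<theta> = 0" shows "wave_rate p q r \<theta> = 0"
proof -
  have "0 \<in> wave_rates p q r \<theta>" using assms(2) by (auto simp: wave_rates_def image_iff intro!: exI[of _ n])
  then have "wave_rate p q r \<theta> \<le> 0" by (intro cInf_lower wave_rates_bdd_below assms)
  with wave_rate_nonneg[OF assms(1)] show ?thesis by (simp add: order_antisym)
qed

text \<open>If the rate is below r, pick s strictly between them. The root of order n + 1 of r^n /
  n^2 tends to r, so all but finitely many terms are at least s and the infimum is a minimum over
  finitely many. A rate of zero would then be attained by a vanishing wave, which genericity
  excludes.\<close>

lemma wave_generic_rate:
  assumes r: "r > 0" and gen: "wave_generic p q \<theta>"
  shows "wave_rate p q r \<theta> > 0"
    and "wave_rate p q r \<theta> = r \<or> (\<exists>k. \<bar>r ^ k * wave p q k \<theta>\<bar> = wave_rate p q r \<theta> ^ Suc k)"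
proof -
  let ?M = "wave_rate p q r \<theta>"
  let ?f = "\<lambda>k. root (Suc k) \<bar>r ^ k * wave p q k \<theta>\<bar>"
  show att: "?M = r \<or> (\<exists>k. \<bar>r ^ k * wave p q k \<theta>\<bar> = ?M ^ Suc k)"
  proof (cases "?M = r")
    case False
    then have "?M < r" using wave_rate_le[OF r, of p q \<theta>] by simp
    then obtain s where s: "?M < s" "s < r" using dense by blast
    have s0: "s > 0" using s wave_rate_nonneg[OF r, of p q \<theta>] by linarith
    \<comment> \<open>With this x, s * (n * x^n)^2 equals s * n^2 * (s / r)^n; that it is below 1
      means s^(n+1) < r^n / n^2, and n * x^n tends to 0 since x < 1.\<close>
    define x where "x = sqrt (s / r)"
    have x: "0 < x" "x < 1" "x\<^sup>2 = s / r" using s s0 r by (auto simp: x_def)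
    have "(\<lambda>n. s * (real n * x ^ n)\<^sup>2) \<longlonglongrightarrow> s * 0\<^sup>2"
      using x by (intro tendsto_intros powser_times_n_limit_0) auto
    then have "\<forall>\<^sub>F n in sequentially. s * (real n * x ^ n)\<^sup>2 < 1"
      by (rule order_tendstoD(2)) simp
    moreover have "\<forall>\<^sub>F n in sequentially. 1 / (real n)\<^sup>2 \<le> \<bar>wave p q n \<theta>\<bar>"
      using gen by (simp add: wave_generic_def)
    ultimately have "\<forall>\<^sub>F n in sequentially. s \<le> ?f n"
      using eventually_ge_at_top[of 1]
    proof eventually_elim
      case (elim n)
      have "(x ^ n)\<^sup>2 = (s / r) ^ n" by (simp flip: x(3) power_mult add: mult.commute)
      then have "s * ((real n)\<^sup>2 * (s ^ n / r ^ n)) < 1" using elim by (simp add: power_mult_distrib power_divide)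
      then have "s * s ^ n * ((real n)\<^sup>2 / r ^ n) < 1" by (simp add: mult_ac)
      then have "s ^ Suc n \<le> r ^ n * (1 / (real n)\<^sup>2)" using elim r
        by (simp add: pos_less_divide_eq pos_divide_less_eq pos_le_divide_eq)
      also have "\<dots> \<le> r ^ n * \<bar>wave p q n \<theta>\<bar>" using elim r by (intro mult_left_mono) auto
      finally have "s ^ Suc n \<le> \<bar>r ^ n * wave p q n \<theta>\<bar>" using r by (simp add: abs_mult)
      then show ?case using s0 by (subst le_root_Suc_iff) auto
    qed
    then obtain N where N: "\<And>n. n \<ge> N \<Longrightarrow> s \<le> ?f n" by (auto simp: eventually_sequentially)
    define F where "F = ?f ` {k. k < N}"
    obtain y where y: "y \<in> wave_rates p q r \<theta>" "y < s"
      using cInf_lessD[OF wave_rates_nonempty s(1)] by blast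
    then obtain k where k: "?f k < s" using s unfolding wave_rates_def by fastforce
    then have "k < N" using N[of k] by linarith
    then have kF: "?f k \<in> F" unfolding F_def using imageI[of k "{k. k < N}" ?f] by simp
    have F: "finite F" by (simp add: F_def)
    have Fk: "Min F \<le> ?f k" by (rule Min_le[OF F kF])
    have "Min F \<in> F" using kF by (intro Min_in F) blast
    then obtain k0 where k0: "Min F = ?f k0" unfolding F_def by (rule imageE)
    have "Min F \<le> y" if "y \<in> wave_rates p q r \<theta>" for y
    proof -
      have "y = r \<or> (\<exists>j. y = ?f j)" using that unfolding wave_rates_def by blast
      then consider "y = r" | j where "y = ?f j" by blast
      then show ?thesis
      proof cases
        case 1
        then show ?thesis using Fk k s by linarith
      next
        case (2 j)
        show ?thesis
        proof (cases "j < N")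
          case True
          then show ?thesis unfolding 2 using imageI[of j "{k. k < N}" ?f] by (intro Min_le F) (simp add: F_def)
        next
          case False
          then have "s \<le> ?f j" using N by simp
          then show ?thesis using Fk k unfolding 2 by linarith
        qed
      qed
    qed
    then have "Min F \<le> ?M" by (rule cInf_greatest[OF wave_rates_nonempty])
    moreover have "?M \<le> ?f k0" by (intro cInf_lower wave_rates_bdd_below r) (simp add: wave_rates_def)
    ultimately have "?M = ?f k0" unfolding k0 by (rule order_antisym[rotated])
    then have "?M ^ Suc k0 = ?f k0 ^ Suc k0" by (rule arg_cong)
    then have "?M ^ Suc k0 = \<bar>r ^ k0 * wave p q k0 \<theta>\<bar>"
      by (simp only: real_root_pow_pos2 zero_less_Suc abs_ge_zero)
    then show ?thesis by (intro disjI2 exI[of _ k0]) (rule sym)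
  qed simp
  show "?M > 0"
  proof (rule ccontr)
    assume "\<not> ?M > 0"
    then have M0: "?M = 0" using wave_rate_nonneg[OF r, of p q \<theta>] by simp
    have nz: "wave p q k \<theta> \<noteq> 0" for k using gen by (simp add: wave_generic_def)
    show False using att nz unfolding M0 using r by auto
  qed
qed

text \<open>Baire category on the line. Near a zero of some wave the smallness condition of
  \<open>V k\<close> holds on an open set, and a generic angle in that open set satisfies the
  nonvanishing condition as well; hence each \<open>V k\<close> is open and dense.\<close>

lemma exists_wave_rate_zero_nonzero_waves:
  assumes "p \<noteq> 0" "r > 0" "s < t"
  shows "\<exists>\<theta>. s < \<theta> \<and> \<theta> < t \<and> wave_rate p q r \<theta> = 0 \<and> (\<forall>n. wave p q n \<theta> \<noteq> 0)"
proof -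
  define V where "V k = {\<theta>. (\<exists>n. \<bar>r ^ n * wave p q n \<theta>\<bar> < (1 / Suc k) ^ Suc n) \<and> wave p q k \<theta> \<noteq> 0}" for k
  have V_open: "open (V k)" for k
    unfolding V_def by (intro open_Collect_conj open_Collect_ex open_Collect_less open_Collect_neq continuous_intros)
  have V_dense: "UNIV \<subseteq> closure (V k)" for k
  proof -
    have "\<exists>y\<in>V k. dist y x < e" if "e > 0" for x e
    proof -
      obtain n \<theta> where th: "x - e < \<theta>" "\<theta> < x + e" "wave p q n \<theta> = 0"
        using exists_wave_zero[of "x - e" "x + e" p q] \<open>e > 0\<close> by auto
      let ?O = "{\<theta>. x - e < \<theta> \<and> \<theta> < x + e \<and> \<bar>r ^ n * wave p q n \<theta>\<bar> < (1 / Suc k) ^ Suc n}"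
      have "open ?O" by (intro open_Collect_conj open_Collect_less continuous_intros)
      moreover have "\<theta> \<in> ?O" using th by simp
      ultimately obtain d where d: "d > 0" "ball \<theta> d \<subseteq> ?O" by (meson open_contains_ball)
      obtain y where y: "\<theta> - d < y" "y < \<theta> + d" "wave_generic p q y"
        using exists_wave_generic[OF assms(1), of "\<theta> - d" "\<theta> + d"] d(1) by auto
      then have "y \<in> ball \<theta> d" by (auto simp: dist_real_def)
      then have yO: "y \<in> ?O" using d(2) by blast
      then have "\<bar>r ^ n * wave p q n y\<bar> < (1 / Suc k) ^ Suc n" by (simp only: mem_Collect_eq)
      moreover have "wave p q k y \<noteq> 0" using y(3) by (simp add: wave_generic_def)
      ultimately have "y \<in> V k" unfolding V_def mem_Collect_eq by (intro conjI exI[of _ n])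
      moreover have "dist y x < e" using yO unfolding mem_Collect_eq dist_real_def abs_less_iff by linarith
      ultimately show ?thesis by blast
    qed
    then show ?thesis by (simp only: closure_approachable subset_eq ball_UNIV) blast
  qed
  have "UNIV \<subseteq> closure (\<Inter>(range V))"
    using V_open V_dense by (intro Baire) auto
  then have "(s + t) / 2 \<in> {s<..<t} \<inter> closure (\<Inter>(range V))" using assms(3) by auto
  then have "{s<..<t} \<inter> \<Inter>(range V) \<noteq> {}"
    using open_Int_closure_eq_empty[of "{s<..<t}" "\<Inter>(range V)"] by (metis empty_iff open_greaterThanLessThan)
  then obtain \<theta> where "\<theta> \<in> {s<..<t}" "\<theta> \<in> \<Inter>(range V)" by blast
  then have th: "s < \<theta>" "\<theta> < t" "\<And>k. \<theta> \<in> V k" by auto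
  have le: "wave_rate p q r \<theta> \<le> 1 / Suc k" for k
  proof (rule ccontr)
    assume *: "\<not> ?thesis"
    obtain n where "\<bar>r ^ n * wave p q n \<theta>\<bar> < (1 / Suc k) ^ Suc n" using th(3)[of k] by (auto simp: V_def)
    moreover have "(1 / Suc k) ^ Suc n \<le> \<bar>r ^ n * wave p q n \<theta>\<bar>"
      using * le_wave_rate_iff[of r "1 / Suc k" p q \<theta>] assms(2) by fastforce
    ultimately show False by simp
  qed
  have "wave_rate p q r \<theta> \<le> 0"
  proof (rule field_le_epsilon)
    fix e :: real assume "e > 0"
    then obtain k where "1 / Suc k < e" using nat_approx_posE by blast
    with le[of k] show "wave_rate p q r \<theta> \<le> 0 + e" by simp
  qed
  then have "wave_rate p q r \<theta> = 0" using wave_rate_nonneg[OF assms(2)] by (simp add: order_antisym)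
  moreover have "wave p q n \<theta> \<noteq> 0" for n using th(3)[of n] by (simp add: V_def)
  ultimately show ?thesis using th by blast
qed

section \<open>Rates that are not attained\<close>

lemma closed_wave_rate_superlevel:
  assumes "r > 0" "x \<ge> 0"
  shows "closed {\<theta>. x \<le> wave_rate p q r \<theta>}"
  unfolding le_wave_rate_iff[OF assms]
  by (intro closed_Collect_conj closed_Collect_all closed_Collect_le continuous_intros closed_Collect_const)

text \<open>The sublevel sets of the waves of index at least \<open>n\<close> have total measure comparable to the
  first of them, and the waves of small index are large near \<open>x\<close>; so a short interval next to
  \<open>x\<close> cannot be covered by them.\<close>
lemma wave_rate_superlevel_accumulates:
  assumes p: "p \<noteq> 0" and r: "r > 0" and \<epsilon>: "0 < \<epsilon>" "\<epsilon> < \<epsilon>'" and x: "\<epsilon>' \<le> wave_rate p q r x"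
  obtains d where "d > 0"
    "\<And>u v. u < v \<Longrightarrow> v - u < d \<Longrightarrow> x - 2 * (v - u) \<le> u \<Longrightarrow> v \<le> x + 2 * (v - u)
      \<Longrightarrow> \<exists>y\<in>{u..v}. \<epsilon> \<le> wave_rate p q r y"
proof -
  define l where "l = \<epsilon> / r"
  define \<kappa> where "\<kappa> = \<epsilon>' / \<epsilon>"
  \<comment> \<open>The threshold with r^n * \<delta> n = \<epsilon>^(n+1): the n-th rate falls
    below \<epsilon> exactly where the n-th wave is smaller than \<delta> n in absolute
    value.\<close>
  define \<delta> where "\<delta> n = r * l ^ Suc n" for n
  have xx: "\<epsilon>' \<le> r" "\<And>n. \<epsilon>' ^ Suc n \<le> \<bar>r ^ n * wave p q n x\<bar>"
    using x le_wave_rate_iff[OF r, of \<epsilon>' p q x] \<epsilon> by auto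
  have l: "0 < l" "l < 1" using \<epsilon> xx(1) r by (auto simp: l_def)
  have k: "\<kappa> > 1" using \<epsilon> by (simp add: \<kappa>_def)
  have \<delta>0: "\<delta> n > 0" for n using r l by (simp add: \<delta>_def)
  have \<delta>_add: "\<delta> (n + j) = l ^ j * \<delta> n" for n j by (simp add: \<delta>_def power_add)
  have \<delta>_antimono: "\<delta> m \<le> \<delta> n" if "n \<le> m" for n m
    unfolding \<delta>_def using that r l by (intro mult_left_mono power_decreasing) auto
  have \<delta>r: "r ^ n * \<delta> n = \<epsilon> ^ Suc n" for n
    using r by (simp add: \<delta>_def l_def power_divide)
  obtain L0 where L0: "L0 > 0" "\<And>n x y. \<bar>wave p q n x - wave p q n y\<bar> \<le> L0 * n * \<bar>x - y\<bar>"
    using wave_lipschitz by blast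
  define L where "L = 2 * L0"
  have L: "L > 0" using L0 by (simp add: L_def)
  \<comment> \<open>At x the wave is at least \<kappa>^(n+1) * \<delta> n, at y it is below \<delta>
    n; the Lipschitz constant, which grows linearly in n, turns this drop into a lower bound for the
    distance.\<close>
  have near: "(\<kappa> ^ Suc n - 1) * \<delta> n \<le> L * n * d"
    if "\<bar>wave p q n y\<bar> < \<delta> n" "\<bar>x - y\<bar> \<le> 2 * d" for n y d
  proof -
    have "r ^ n * (\<kappa> ^ Suc n * \<delta> n) = \<kappa> ^ Suc n * \<epsilon> ^ Suc n" by (metis \<delta>r mult.left_commute)
    also have "\<dots> = \<epsilon>' ^ Suc n" unfolding \<kappa>_def power_mult_distrib[symmetric] using \<epsilon> by simp
    also have "\<dots> \<le> r ^ n * \<bar>wave p q n x\<bar>" using xx(2)[of n] r by (simp add: abs_mult)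
    finally have "\<kappa> ^ Suc n * \<delta> n \<le> \<bar>wave p q n x\<bar>" using r by (simp del: power_Suc)
    moreover have "\<bar>wave p q n x\<bar> \<le> \<bar>wave p q n y\<bar> + L0 * n * \<bar>x - y\<bar>" using L0(2)[of n x y] by linarith
    moreover have "L0 * n * \<bar>x - y\<bar> \<le> L0 * n * (2 * d)"
      using that(2) L0(1) by (intro mult_left_mono) auto
    ultimately show ?thesis using that(1) unfolding L_def left_diff_distrib by (simp add: mult_ac)
  qed
  \<comment> \<open>Chosen so that 18 / |p| * g * d = d (1 - l): a first bad set with measure bound
    below this leads to a geometric series with sum below d.\<close>
  define g where "g = \<bar>p\<bar> * (1 - l) / 18"
  have g: "g > 0" using p l by (simp add: g_def)
  \<comment> \<open>The measure bound for the first bad set has a part proportional to d and a part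
    proportional to 1 / n0. \<open>N1\<close> keeps the first below half of the allowance given by
    \<open>g\<close>, and \<open>N2\<close> the second.\<close>
  obtain N1 where N1: "l ^ N1 < g / (2 * r)" using real_arch_pow_inv[of "g / (2 * r)" l] g r l by auto
  obtain N2 where N2: "2 * L / g + 1 < \<kappa> ^ N2" using real_arch_pow[OF k] by blast
  define N where "N = max N1 N2"
  have NN: "\<delta> n < g / 2" "2 * L / g < \<kappa> ^ Suc n - 1" if "n \<ge> N" for n
  proof -
    have "l ^ Suc n \<le> l ^ N1" using that l by (intro power_decreasing) (auto simp: N_def)
    then have "l ^ Suc n < g / (2 * r)" using N1 by linarith
    then have "r * l ^ Suc n < r * (g / (2 * r))" using r by (intro mult_strict_left_mono)
    then show "\<delta> n < g / 2" using r by (simp add: \<delta>_def)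
    have "\<kappa> ^ N2 \<le> \<kappa> ^ Suc n" using that k by (intro power_increasing) (auto simp: N_def)
    then show "2 * L / g < \<kappa> ^ Suc n - 1" using N2 by linarith
  qed
  \<comment> \<open>On intervals shorter than this, \<open>near\<close> prevents every wave of index
    at most N from dropping below its threshold.\<close>
  define d0 where "d0 = (\<kappa> - 1) * \<delta> N / (L * N + 1)"
  have LN: "L * N + 1 > 0" using L by (simp add: add_nonneg_pos)
  have d0: "d0 > 0" unfolding d0_def using k \<delta>0 LN by simp
  show ?thesis
  proof (rule that[OF d0])
    fix u v assume uv: "u < v" "v - u < d0" "x - 2 * (v - u) \<le> u" "v \<le> x + 2 * (v - u)"
    define d where "d = v - u"
    have d: "0 < d" "d < d0" using uv by (auto simp: d_def)
    have close: "\<bar>x - y\<bar> \<le> 2 * d" if "y \<in> {u..v}" for y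
      using that uv unfolding d_def by auto
    define K where "K n = {y::real \<in> {u..v}. \<bar>wave p q n y\<bar> < \<delta> n}" for n
    have K_big: "n > N" if "K n \<noteq> {}" for n
    proof (rule ccontr)
      assume "\<not> n > N"
      then have nN: "n \<le> N" by simp
      obtain y where "y \<in> {u..v}" "\<bar>wave p q n y\<bar> < \<delta> n" using \<open>K n \<noteq> {}\<close> unfolding K_def by blast
      then have "(\<kappa> ^ Suc n - 1) * \<delta> n \<le> L * n * d" using near close by blast
      also have "\<dots> \<le> L * N * d" using nN L d by (intro mult_right_mono mult_left_mono) auto
      also have "\<dots> \<le> (L * N + 1) * d" using d by (intro mult_right_mono) auto
      also have "\<dots> < (L * N + 1) * d0" using LN d by (intro mult_strict_left_mono)
      also have "\<dots> = (\<kappa> - 1) * \<delta> N" unfolding d0_def using LN by (simp add: field_simps)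
      also have "\<dots> \<le> (\<kappa> ^ Suc n - 1) * \<delta> n"
      proof -
        have "\<kappa> \<le> \<kappa> ^ Suc n" using k power_increasing[of 1 "Suc n" \<kappa>] by simp
        then show ?thesis using k \<delta>_antimono[OF nN] less_imp_le[OF \<delta>0[of N]] by (intro mult_mono) linarith+
      qed
      finally show False by simp
    qed
    show "\<exists>y\<in>{u..v}. \<epsilon> \<le> wave_rate p q r y"
    proof (rule ccontr)
      assume no: "\<not> ?thesis"
      have cover: "\<exists>n. y \<in> K n" if y: "y \<in> {u..v}" for y
      proof -
        have "\<not> \<epsilon> \<le> wave_rate p q r y" using no y by blast
        then obtain n where "\<bar>r ^ n * wave p q n y\<bar> < \<epsilon> ^ Suc n"
          using le_wave_rate_iff[OF r, of \<epsilon> p q y] \<epsilon> xx(1) by (auto simp: not_le)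
        then have "r ^ n * \<bar>wave p q n y\<bar> < r ^ n * \<delta> n" unfolding \<delta>r using r by (simp add: abs_mult)
        then show ?thesis using r y by (auto simp: K_def)
      qed
      have "u \<in> {u..v}" using uv by simp
      then have ex: "\<exists>n. K n \<noteq> {}" using cover by blast
      \<comment> \<open>The decisive choice: \<open>near\<close>, applied at a point of the first
        nonempty bad set, bounds \<delta> n0 / n0 by a small multiple of d. So the endpoint term 1 /
        n0 of the measure bound is harmless although the interval may be much shorter than the
        periods involved.\<close>
      define n0 where "n0 = (LEAST n. K n \<noteq> {})"
      have n0: "K n0 \<noteq> {}" unfolding n0_def using ex by (rule LeastI_ex)
      have n0_le: "n0 \<le> n" if "K n \<noteq> {}" for n unfolding n0_def using that by (rule Least_le)
      have n0N: "n0 > N" by (rule K_big[OF n0])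
      define C where "C = 18 * (\<delta> n0 / \<bar>p\<bar>) * (d + 1 / n0)"
      have C: "C < d * (1 - l)"
      proof -
        obtain y where "y \<in> {u..v}" "\<bar>wave p q n0 y\<bar> < \<delta> n0" using n0 unfolding K_def by blast
        then have "(\<kappa> ^ Suc n0 - 1) * \<delta> n0 \<le> L * n0 * d" using near close by blast
        moreover have "2 * L / g * \<delta> n0 \<le> (\<kappa> ^ Suc n0 - 1) * \<delta> n0"
          using NN(2)[of n0] n0N \<delta>0[of n0] by (intro mult_right_mono) auto
        ultimately have "L * (2 / g * \<delta> n0) \<le> L * (n0 * d)" by (simp add: mult_ac)
        then have "2 / g * \<delta> n0 \<le> n0 * d" using L by (simp only: mult_le_cancel_left_pos)
        then have "\<delta> n0 * (1 / n0) \<le> d * (g / 2)" using n0N g by (simp add: field_simps)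
        moreover have "\<delta> n0 * d < d * (g / 2)" unfolding mult.commute[of d] using NN(1)[of n0] n0N d by (intro mult_strict_right_mono) auto
        ultimately have "\<delta> n0 * (d + 1 / n0) < g * d"
        proof -
          have "g * d = d * (g / 2) + d * (g / 2)" by simp
          with \<open>\<delta> n0 * (1 / n0) \<le> d * (g / 2)\<close> \<open>\<delta> n0 * d < d * (g / 2)\<close> show ?thesis
            unfolding distrib_left by linarith
        qed
        then have "18 / \<bar>p\<bar> * (\<delta> n0 * (d + 1 / n0)) < 18 / \<bar>p\<bar> * (g * d)"
          using p by (intro mult_strict_left_mono) auto
        moreover have "18 / \<bar>p\<bar> * (\<delta> n0 * (d + 1 / n0)) = C" by (simp add: C_def)
        moreover have "18 / \<bar>p\<bar> * (g * d) = d * (1 - l)" using p by (simp add: g_def)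
        ultimately show ?thesis by (simp only:)
      qed
      have C0: "C \<ge> 0" unfolding C_def using \<delta>0[of n0] d by simp
      have K_meas: "K n \<in> lmeasurable" for n
        unfolding K_def by (intro borel_subset_interval_fmeasurable[of _ u v]) auto
      have mK: "measure lebesgue (K (n0 + j)) \<le> C * l ^ j" for j
      proof -
        have "measure lebesgue (K (n0 + j)) \<le> 18 * (\<delta> (n0 + j) / \<bar>p\<bar>) * (d + 1 / (n0 + j))"
          unfolding K_def d_def using uv n0N p \<delta>0[of "n0 + j"] by (intro measure_abs_wave_less) auto
        also have "\<dots> \<le> 18 * (\<delta> (n0 + j) / \<bar>p\<bar>) * (d + 1 / n0)"
          using n0N \<delta>0[of "n0 + j"] by (intro mult_left_mono add_left_mono divide_left_mono) auto
        also have "\<dots> = C * l ^ j" by (simp add: C_def \<delta>_add)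
        finally show ?thesis .
      qed
      have gs: "(\<lambda>j. C * l ^ j) sums (C * (1 / (1 - l)))"
        using l by (intro sums_mult geometric_sums) auto
      have sub: "{u..v} \<subseteq> (\<Union>j. K (n0 + j))"
      proof
        fix y assume "y \<in> {u..v}"
        then obtain n where n: "y \<in> K n" using cover by blast
        then have "n0 \<le> n" by (intro n0_le) blast
        then have "n = n0 + (n - n0)" by simp
        with n have "y \<in> K (n0 + (n - n0))" by simp
        then show "y \<in> (\<Union>j. K (n0 + j))" by blast
      qed
      have "emeasure lebesgue {u..v} \<le> emeasure lebesgue (\<Union>j. K (n0 + j))"
        using K_meas by (intro emeasure_mono sub sets.countable_UN) auto
      also have "\<dots> \<le> (\<Sum>j. emeasure lebesgue (K (n0 + j)))"
        using K_meas by (intro emeasure_subadditive_countably) auto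
      also have "\<dots> \<le> (\<Sum>j. ennreal (C * l ^ j))"
        using mK K_meas by (intro suminf_le) (auto simp: emeasure_eq_measure2 intro!: ennreal_leI)
      also have "\<dots> = ennreal (C * (1 / (1 - l)))"
        using gs C0 l by (intro suminf_ennreal_eq) auto
      finally have "ennreal d \<le> ennreal (C * (1 / (1 - l)))" using uv by (simp add: d_def)
      then have "d \<le> C * (1 / (1 - l))" using C0 l by (simp add: ennreal_le_iff)
      then have "d * (1 - l) \<le> C" using l by (simp add: field_simps)
      with C show False by linarith
    qed
  qed
qed

text \<open>Otherwise all points of F near \<theta> have rate at least \<epsilon>'. A wave zero near
  \<theta> lies in a gap of F, and the end x of this gap facing \<theta> belongs to F. The
  accumulation lemma at x then produces a point of F inside the gap.\<close>

lemma wave_rate_level_dense: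
  assumes p: "p \<noteq> 0" and r: "r > 0" and \<epsilon>: "0 < \<epsilon>" "\<epsilon> < \<epsilon>'" and e: "e > 0"
    and \<theta>: "\<epsilon> \<le> wave_rate p q r \<theta>"
  shows "\<exists>y. \<epsilon> \<le> wave_rate p q r y \<and> wave_rate p q r y < \<epsilon>' \<and> dist y \<theta> < e"
proof (rule ccontr)
  assume no: "\<not> ?thesis"
  define F where "F = {\<theta>. \<epsilon> \<le> wave_rate p q r \<theta>}"
  have F: "closed F" unfolding F_def using \<epsilon> by (intro closed_wave_rate_superlevel r) auto
  have big: "\<epsilon>' \<le> wave_rate p q r y" if "y \<in> F" "dist y \<theta> < e" for y
    using no that unfolding F_def by (auto simp: not_less)
  have \<theta>F: "\<theta> \<in> F" using \<theta> by (simp add: F_def)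
  obtain n z where z: "\<theta> - e < z" "z < \<theta> + e" "wave p q n z = 0"
    using exists_wave_zero[of "\<theta> - e" "\<theta> + e" p q] e by auto
  then have zF: "z \<notin> F" using wave_rate_eq_0[OF r z(3)] \<epsilon> by (simp add: F_def)
  then have "z \<noteq> \<theta>" using \<theta>F by blast
  then consider "z < \<theta>" | "z > \<theta>" by linarith
  then show False
  proof cases
    case 1
    let ?S = "F \<inter> {z..\<theta>}"
    define x where "x = Inf ?S"
    have S: "closed ?S" "bdd_below ?S" "?S \<noteq> {}" using F \<theta>F 1 by (auto intro: closed_Int)
    have xS: "x \<in> ?S" unfolding x_def by (rule closed_contains_Inf[OF S(3,2,1)])
    then have x: "z < x" "x \<le> \<theta>" "x \<in> F" using zF by (auto simp: order.strict_iff_order)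
    have "\<epsilon>' \<le> wave_rate p q r x" using x z by (intro big) (auto simp: dist_real_def)
    then obtain d where d: "d > 0" "\<And>u v. u < v \<Longrightarrow> v - u < d \<Longrightarrow> x - 2 * (v - u) \<le> u \<Longrightarrow> v \<le> x + 2 * (v - u)
      \<Longrightarrow> \<exists>y\<in>{u..v}. \<epsilon> \<le> wave_rate p q r y"
      using wave_rate_superlevel_accumulates[OF p r \<epsilon>] by blast
    define c where "c = min d (x - z)"
    have c: "c > 0" "c \<le> d" "c \<le> x - z" using d(1) x by (auto simp: c_def)
    \<comment> \<open>The interval stays away from x by its own length c / 2, which puts y strictly
      inside the gap and still meets the distance condition x - 2 (v - u) <= u, with
      equality.\<close>
    obtain y where y: "y \<in> {x - c .. x - c / 2}" "\<epsilon> \<le> wave_rate p q r y"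
      using d(2)[of "x - c" "x - c / 2"] c by auto
    then have "y \<in> ?S" using c x by (auto simp: F_def)
    then have "x \<le> y" unfolding x_def using S(2) by (intro cInf_lower)
    then show False using y c by auto
  next
    case 2
    let ?S = "F \<inter> {\<theta>..z}"
    define x where "x = Sup ?S"
    have S: "closed ?S" "bdd_above ?S" "?S \<noteq> {}" using F \<theta>F 2 by (auto intro: closed_Int)
    have "x \<in> ?S" unfolding x_def by (rule closed_contains_Sup[OF S(3,2,1)])
    then have x: "x < z" "\<theta> \<le> x" "x \<in> F" using zF by (auto simp: order.strict_iff_order)
    have "\<epsilon>' \<le> wave_rate p q r x" using x z by (intro big) (auto simp: dist_real_def)
    then obtain d where d: "d > 0" "\<And>u v. u < v \<Longrightarrow> v - u < d \<Longrightarrow> x - 2 * (v - u) \<le> u \<Longrightarrow> v \<le> x + 2 * (v - u)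
      \<Longrightarrow> \<exists>y\<in>{u..v}. \<epsilon> \<le> wave_rate p q r y"
      using wave_rate_superlevel_accumulates[OF p r \<epsilon>] by blast
    define c where "c = min d (z - x)"
    have c: "c > 0" "c \<le> d" "c \<le> z - x" using d(1) x by (auto simp: c_def)
    obtain y where y: "y \<in> {x + c / 2 .. x + c}" "\<epsilon> \<le> wave_rate p q r y"
      using d(2)[of "x + c / 2" "x + c"] c by auto
    then have "y \<in> ?S" using c x by (auto simp: F_def)
    then have "y \<le> x" unfolding x_def using S(2) by (intro cSup_upper)
    then show False using y c by auto
  qed
qed

text \<open>The level \<open>\<epsilon>\<close> avoids the countably many suprema of the rate over rational intervals; then
  \<open>{\<theta>. wave_rate p q r \<theta> > \<epsilon>}\<close> is dense in the superlevel set, on which the Baire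
  category theorem is applied.\<close>
lemma exists_wave_rate_not_attained:
  assumes p: "p \<noteq> 0" and r: "r > 0" and st: "s < t"
  shows "\<exists>\<theta>. s < \<theta> \<and> \<theta> < t \<and> 0 < wave_rate p q r \<theta> \<and> wave_rate p q r \<theta> < r
    \<and> (\<forall>k. \<bar>r ^ k * wave p q k \<theta>\<bar> \<noteq> wave_rate p q r \<theta> ^ Suc k)"
proof -
  let ?f = "wave_rate p q r"
  obtain \<theta>0 where \<theta>0: "s < \<theta>0" "\<theta>0 < t" "wave_generic p q \<theta>0"
    using exists_wave_generic[OF p st] by blast
  have f0: "?f \<theta>0 > 0" by (rule wave_generic_rate(1)[OF r \<theta>0(3)])
  define S where "S = (\<lambda>(a, b). Sup (?f ` {a<..<b})) ` (\<rat> \<times> \<rat>)"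
  have "countable S" unfolding S_def by (intro countable_image countable_SIGMA countable_rat)
  moreover have "uncountable {0<..<?f \<theta>0}" using f0 uncountable_open_interval by blast
  ultimately have "\<not> {0<..<?f \<theta>0} \<subseteq> S" using countable_subset by blast
  then obtain \<epsilon> where "\<epsilon> \<in> {0<..<?f \<theta>0}" "\<epsilon> \<notin> S" by blast
  then have \<epsilon>: "0 < \<epsilon>" "\<epsilon> < ?f \<theta>0" "\<epsilon> \<notin> S" by simp_all
  define F where "F = {\<theta>. \<epsilon> \<le> ?f \<theta>}"
  have F: "closed F" unfolding F_def using \<epsilon> by (intro closed_wave_rate_superlevel r) auto
  \<comment> \<open>A point in all \<open>T k\<close> has rate exactly \<epsilon>, while no term
    equals \<epsilon>^(k+1); since \<epsilon> < r, the infimum is not attained.\<close>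
  define T where "T k = {\<theta> \<in> F. ?f \<theta> < \<epsilon> + 1 / Suc k \<and> \<bar>r ^ k * wave p q k \<theta>\<bar> \<noteq> \<epsilon> ^ Suc k}" for k
  \<comment> \<open>Between rational endpoints around \<theta> the supremum of the rate is at least
    \<epsilon> and belongs to \<open>S\<close>, so it differs from \<epsilon> and is larger.\<close>
  have above: "\<exists>y. \<epsilon> < ?f y \<and> dist y \<theta> < e" if "\<theta> \<in> F" "e > 0" for \<theta> e
  proof -
    obtain a where a: "a \<in> \<rat>" "\<theta> - e < a" "a < \<theta>" using Rats_dense_in_real[of "\<theta> - e" \<theta>] \<open>e > 0\<close> by auto
    obtain b where b: "b \<in> \<rat>" "\<theta> < b" "b < \<theta> + e" using Rats_dense_in_real[of \<theta> "\<theta> + e"] \<open>e > 0\<close> by auto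
    let ?I = "?f ` {a<..<b}"
    have bdd: "bdd_above ?I" using wave_rate_le[OF r] by (auto simp: bdd_above_def)
    have ne: "?I \<noteq> {}" using a b by auto
    have "?f \<theta> \<le> Sup ?I" using a b by (intro cSup_upper bdd) auto
    moreover have "Sup ?I \<in> S" unfolding S_def using a b by (auto intro!: image_eqI[of _ _ "(a, b)"])
    then have "Sup ?I \<noteq> \<epsilon>" using \<epsilon>(3) by blast
    ultimately have "\<epsilon> < Sup ?I" using \<open>\<theta> \<in> F\<close> by (simp add: F_def)
    then obtain y where "y \<in> {a<..<b}" "\<epsilon> < ?f y" using less_cSup_iff[OF ne bdd] by blast
    then show ?thesis using a b by (intro exI[of _ y]) (auto simp: dist_real_def)
  qed
  have T: "openin (top_of_set F) (T k)" "F \<subseteq> closure (T k)" for k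
  proof -
    have "open (- {\<theta>. \<epsilon> + 1 / Suc k \<le> ?f \<theta>})"
      using \<epsilon> by (intro open_Compl closed_wave_rate_superlevel r) simp
    moreover have "open {\<theta>. \<bar>r ^ k * wave p q k \<theta>\<bar> \<noteq> \<epsilon> ^ Suc k}"
      by (intro open_Collect_neq continuous_intros)
    moreover have "T k = F \<inter> (- {\<theta>. \<epsilon> + 1 / Suc k \<le> ?f \<theta>} \<inter> {\<theta>. \<bar>r ^ k * wave p q k \<theta>\<bar> \<noteq> \<epsilon> ^ Suc k})"
      by (auto simp: T_def)
    ultimately show "openin (top_of_set F) (T k)" by (metis openin_open_Int open_Int)
    have "\<exists>y\<in>T k. dist y \<theta> < e" if "\<theta> \<in> F" "e > 0" for \<theta> e
    proof -
      \<comment> \<open>Two moves: first to y, where the rate is close to \<epsilon>, then to w so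
        near y that the rate keeps its upper bound but exceeds \<epsilon>. The latter pushes the
        k-th term strictly above \<epsilon>^(k+1).\<close>
      obtain y where y: "\<epsilon> \<le> ?f y" "?f y < \<epsilon> + 1 / Suc k" "dist y \<theta> < e / 2"
        using wave_rate_level_dense[OF p r \<epsilon>(1), of "\<epsilon> + 1 / Suc k" "e / 2" q \<theta>] \<open>\<theta> \<in> F\<close> \<open>e > 0\<close> by (auto simp: F_def)
      have "open (- {\<theta>. \<epsilon> + 1 / Suc k \<le> ?f \<theta>})" by fact
      then obtain c where c: "c > 0" "ball y c \<subseteq> - {\<theta>. \<epsilon> + 1 / Suc k \<le> ?f \<theta>}"
        using y(2) by (force simp: open_contains_ball)
      obtain w where w: "\<epsilon> < ?f w" "dist w y < min c (e / 2)"
        using above[of y "min c (e / 2)"] y c \<open>e > 0\<close> by (auto simp: F_def)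
      have "?f w < \<epsilon> + 1 / Suc k" using c w(2) by (auto simp: subset_eq dist_commute not_le)
      moreover have "\<epsilon> ^ Suc k < \<bar>r ^ k * wave p q k w\<bar>"
      proof -
        have "\<epsilon> ^ Suc k < ?f w ^ Suc k" using w \<epsilon> by (intro power_strict_mono) auto
        also have "\<dots> \<le> \<bar>r ^ k * wave p q k w\<bar>"
          using le_wave_rate_iff[OF r, of "?f w" p q w] wave_rate_nonneg[OF r, of p q w] by blast
        finally show ?thesis .
      qed
      moreover have "dist w \<theta> < e" using w(2) y(3) dist_triangle[of w \<theta> y] by simp
      ultimately show ?thesis using w by (intro bexI[of _ w]) (auto simp: T_def F_def)
    qed
    then show "F \<subseteq> closure (T k)" unfolding closure_approachable subset_eq by blast
  qed
  have "F \<subseteq> closure (\<Inter>(range T))"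
    using F T by (intro Baire) auto
  moreover have "\<theta>0 \<in> F" using \<epsilon> by (simp add: F_def)
  ultimately have "\<theta>0 \<in> {s<..<t} \<inter> closure (\<Inter>(range T))" using \<theta>0 by auto
  then have "{s<..<t} \<inter> \<Inter>(range T) \<noteq> {}"
    using open_Int_closure_eq_empty[of "{s<..<t}" "\<Inter>(range T)"] by (metis empty_iff open_greaterThanLessThan)
  then obtain \<theta> where "\<theta> \<in> {s<..<t}" "\<theta> \<in> \<Inter>(range T)" by blast
  then have th: "s < \<theta>" "\<theta> < t" "\<And>k. \<theta> \<in> T k" by auto
  have "?f \<theta> \<le> \<epsilon>"
  proof (rule field_le_epsilon)
    fix e :: real assume "e > 0"
    then obtain k where "1 / Suc k < e" using nat_approx_posE by blast
    then show "?f \<theta> \<le> \<epsilon> + e" using th(3)[of k] by (simp add: T_def)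
  qed
  then have "?f \<theta> = \<epsilon>" using th(3)[of 0] by (simp add: T_def F_def)
  moreover have "\<epsilon> < r" using \<epsilon>(2) wave_rate_le[OF r, of p q \<theta>0] by linarith
  moreover have "\<bar>r ^ k * wave p q k \<theta>\<bar> \<noteq> \<epsilon> ^ Suc k" for k using th(3)[of k] by (simp add: T_def)
  ultimately show ?thesis using th \<epsilon>(1) by blast
qed

section \<open>Density and continuity\<close>

context rank_one_rotation
begin

lemma trace_seq_wave: "trace_seq A n = r ^ n * wave (trace P) (trace (P ** J)) n \<theta>"
  by (simp add: trace_seq_eq wave_def)

lemma rates_wave: "rates A = wave_rates (trace P) (trace (P ** J)) r \<theta>"
  by (simp add: rates_eq wave_rates_def trace_seq_wave)

lemma trace_seq_eq_0_iff: "trace_seq A n = 0 \<longleftrightarrow> wave (trace P) (trace (P ** J)) n \<theta> = 0"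
  using r by (simp add: trace_seq_wave)

end

lemma PP_EE_cases:
  assumes "A \<in> PP \<times> EE"
  obtains P J r \<theta> where "rank_one_rotation P J r \<theta>" "A = (P, rot r \<theta> J)"
proof -
  obtain P B where A: "A = (P, B)" "P \<in> PP" "B \<in> EE" using assms by auto
  show ?thesis
    using A EE_rot_cases[OF A(3)] that by (auto simp: PP_iff rank_one_rotation_def)
qed

lemma lower_spectral_radius_nonneg: "A \<in> PP \<times> EE \<Longrightarrow> lower_spectral_radius A \<ge> 0"
  by (metis PP_EE_cases rank_one_rotation.lower_spectral_radius_eq rank_one_rotation.rate_nonneg)

lemma lower_spectral_radius_le_trace_seq:
  "A \<in> PP \<times> EE \<Longrightarrow> lower_spectral_radius A ^ Suc k \<le> \<bar>trace_seq A k\<bar>"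
  by (metis PP_EE_cases rank_one_rotation.lower_spectral_radius_eq rank_one_rotation.rate_le_trace_seq)

lemma lower_spectral_radius_0D:
  assumes "A \<in> PP \<times> EE" "lower_spectral_radius A = 0" "e > 0"
  shows "\<exists>k. \<bar>trace_seq A k\<bar> < e ^ Suc k"
proof -
  obtain P J r \<theta> where R: "rank_one_rotation P J r \<theta>" and A: "A = (P, rot r \<theta> J)"
    using PP_EE_cases assms(1) by blast
  interpret rank_one_rotation P J r \<theta> by (rule R)
  have "Inf (rates A) < min e r" using assms r unfolding A lower_spectral_radius_eq by simp
  then obtain s where s: "s \<in> rates A" "s < min e r"
    using cInf_lessD[OF rates_nonempty] unfolding A by blast
  then obtain k where k: "root (Suc k) \<bar>trace_seq A k\<bar> < e"
    unfolding A rates_eq by auto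
  have "\<bar>trace_seq A k\<bar> = root (Suc k) \<bar>trace_seq A k\<bar> ^ Suc k"
    by (simp only: real_root_pow_pos2 zero_less_Suc abs_ge_zero)
  also have "\<dots> < e ^ Suc k" using k by (intro power_strict_mono) auto
  finally show ?thesis by blast
qed

lemma lower_finiteness_property_0_iff:
  assumes "A \<in> PP \<times> EE" "lower_spectral_radius A = 0"
  shows "lower_finiteness_property A \<longleftrightarrow> (\<exists>k. trace_seq A k = 0)"
proof -
  obtain P J r \<theta> where R: "rank_one_rotation P J r \<theta>" and A: "A = (P, rot r \<theta> J)"
    using PP_EE_cases assms(1) by blast
  interpret rank_one_rotation P J r \<theta> by (rule R)
  show ?thesis using assms(2) r unfolding A lower_spectral_radius_eq lower_finiteness_property_iff by simp
qed

lemma continuous_on_matrix_mult [continuous_intros]: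
  fixes f g :: "'a::topological_space \<Rightarrow> mat2"
  assumes "continuous_on S f" "continuous_on S g"
  shows "continuous_on S (\<lambda>x. f x ** g x)"
  unfolding matrix_matrix_mult_def by (intro continuous_intros assms)

lemma continuous_on_trace_seq: "continuous_on UNIV (\<lambda>A. trace_seq A n)"
proof -
  have "continuous_on UNIV (\<lambda>B. mat_power B n)"
  proof (induction n)
    case (Suc n)
    then show ?case by (simp add: continuous_on_matrix_mult)
  qed simp
  then have "continuous_on UNIV (\<lambda>A :: mat2 \<times> mat2. mat_power (snd A) n)"
    by (rule continuous_on_compose2) (auto intro: continuous_intros)
  then show ?thesis unfolding trace_seq_def trace_2 by (intro continuous_intros)
qed

text \<open>A single trace certifies that the radius is below e, and by continuity of that trace the
  same certificate is valid nearby.\<close>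

lemma continuous_at_zero_lower_spectral_radius:
  assumes "A \<in> PP \<times> EE" "lower_spectral_radius A = 0"
  shows "continuous (at A within PP \<times> EE) lower_spectral_radius"
  unfolding continuous_within assms(2)
proof (rule tendstoI)
  fix e :: real assume e: "e > 0"
  obtain k where k: "\<bar>trace_seq A k\<bar> < e ^ Suc k" using lower_spectral_radius_0D[OF assms e] by blast
  have "((\<lambda>A'. trace_seq A' k) \<longlongrightarrow> trace_seq A k) (at A within PP \<times> EE)"
    using continuous_on_subset[OF continuous_on_trace_seq subset_UNIV] assms(1)
    unfolding continuous_on_def by blast
  then have "((\<lambda>A'. \<bar>trace_seq A' k\<bar>) \<longlongrightarrow> \<bar>trace_seq A k\<bar>) (at A within PP \<times> EE)"
    by (rule tendsto_rabs)
  then have "\<forall>\<^sub>F A' in at A within PP \<times> EE. \<bar>trace_seq A' k\<bar> < e ^ Suc k"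
    using k by (rule order_tendstoD)
  moreover have "\<forall>\<^sub>F A' in at A within PP \<times> EE. A' \<in> PP \<times> EE"
    by (simp add: eventually_at_filter)
  ultimately show "\<forall>\<^sub>F A' in at A within PP \<times> EE. dist (lower_spectral_radius A') 0 < e"
  proof eventually_elim
    case (elim A')
    then have "lower_spectral_radius A' ^ Suc k < e ^ Suc k"
      using lower_spectral_radius_le_trace_seq[OF elim(2), of k] by linarith
    then have "lower_spectral_radius A' < e" by (rule power_less_imp_less_base) (use e in simp)
    then show ?case using lower_spectral_radius_nonneg[OF elim(2)] by (simp add: dist_real_def)
  qed
qed

lemma dense_within_superset:
  assumes "dense_within X S" "S \<subseteq> T" "T \<subseteq> X"
  shows "dense_within X T"
proof -
  have "top_of_set X closure_of S \<subseteq> top_of_set X closure_of T" by (intro closure_of_mono assms)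
  moreover have "top_of_set X closure_of T \<subseteq> X" using closure_of_subset_topspace[of "top_of_set X" T] by simp
  ultimately show ?thesis using assms unfolding dense_within_def by auto
qed

text \<open>With P, J and r fixed the pair depends continuously on the angle, so each neighbourhood
  of a pair contains a whole arc of pairs. The limits 0 and pi keep the arc inside
  \<open>EE\<close>.\<close>

lemma dense_within_by_angle:
  assumes "S \<subseteq> PP \<times> EE"
    and ex: "\<And>P J r s t. det P = 0 \<Longrightarrow> trace P \<noteq> 0 \<Longrightarrow> J ** J = - mat 1 \<Longrightarrow> r > 0 \<Longrightarrow> 0 \<le> s \<Longrightarrow> s < t \<Longrightarrow> t \<le> pi
      \<Longrightarrow> \<exists>\<theta>. s < \<theta> \<and> \<theta> < t \<and> (P, rot r \<theta> J) \<in> S"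
  shows "dense_within (PP \<times> EE) S"
  unfolding dense_within_def
proof (intro conjI assms(1))
  have "\<exists>y. y \<in> S \<and> y \<in> T" if A: "A \<in> PP \<times> EE" "A \<in> T" "openin (top_of_set (PP \<times> EE)) T" for A T
  proof -
    obtain W where W: "open W" "T = (PP \<times> EE) \<inter> W" using A(3) openin_open by blast
    obtain P J r \<theta> where R: "rank_one_rotation P J r \<theta>" and AA: "A = (P, rot r \<theta> J)"
      using PP_EE_cases A(1) by blast
    interpret rank_one_rotation P J r \<theta> by (rule R)
    have "continuous_on UNIV (\<lambda>x. (P, rot r x J))"
      unfolding rot_def by (intro continuous_intros)
    then have "open ((\<lambda>x. (P, rot r x J)) -` W)" using W(1) by (simp add: continuous_on_open_vimage)
    moreover have "\<theta> \<in> (\<lambda>x. (P, rot r x J)) -` W" using A(2) W(2) AA by simp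
    ultimately obtain d where d: "d > 0" "ball \<theta> d \<subseteq> (\<lambda>x. (P, rot r x J)) -` W"
      by (meson open_contains_ball)
    obtain y where y: "max 0 (\<theta> - d) < y" "y < min pi (\<theta> + d)" "(P, rot r y J) \<in> S"
      using ex[OF det_P trace_P J r, of "max 0 (\<theta> - d)" "min pi (\<theta> + d)"] d(1) \<theta> by auto
    have "y \<in> ball \<theta> d" using y by (auto simp: dist_real_def)
    then have "(P, rot r y J) \<in> W" using d(2) by auto
    then show ?thesis using y(3) assms(1) W(2) by blast
  qed
  then show "top_of_set (PP \<times> EE) closure_of S = PP \<times> EE"
    by (auto simp: in_closure_of)
qed

section \<open>The four sets and their density\<close>

lemma U1_eq: "U1 = {A \<in> PP \<times> EE. lower_spectral_radius A = 0 \<and> (\<forall>n. trace_seq A n \<noteq> 0)}"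
  unfolding U1_def using lower_finiteness_property_0_iff continuous_at_zero_lower_spectral_radius by blast

lemma U2_eq: "U2 = {A \<in> PP \<times> EE. lower_spectral_radius A = 0 \<and> (\<exists>n. trace_seq A n = 0)}"
  unfolding U2_def using lower_finiteness_property_0_iff continuous_at_zero_lower_spectral_radius by blast

lemma dense_U1: "dense_within (PP \<times> EE) U1"
proof (rule dense_within_by_angle)
  fix P J :: mat2 and r s t :: real
  assume a: "det P = 0" "trace P \<noteq> 0" "J ** J = - mat 1" "r > 0" "0 \<le> s" "s < t" "t \<le> pi"
  obtain \<theta> where th: "s < \<theta>" "\<theta> < t" "wave_rate (trace P) (trace (P ** J)) r \<theta> = 0"
    "\<And>n. wave (trace P) (trace (P ** J)) n \<theta> \<noteq> 0"
    using exists_wave_rate_zero_nonzero_waves[OF a(2,4,6)] by blast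
  interpret rank_one_rotation P J r \<theta> using a th by unfold_locales auto
  have "A \<in> U1" using th in_PP_EE unfolding U1_eq
    by (simp add: lower_spectral_radius_eq rates_wave trace_seq_eq_0_iff)
  with th show "\<exists>\<theta>. s < \<theta> \<and> \<theta> < t \<and> (P, rot r \<theta> J) \<in> U1" by blast
qed (auto simp: U1_def)

lemma dense_U2: "dense_within (PP \<times> EE) U2"
proof (rule dense_within_by_angle)
  fix P J :: mat2 and r s t :: real
  assume a: "det P = 0" "trace P \<noteq> 0" "J ** J = - mat 1" "r > 0" "0 \<le> s" "s < t" "t \<le> pi"
  obtain n \<theta> where th: "s < \<theta>" "\<theta> < t" "wave (trace P) (trace (P ** J)) n \<theta> = 0"
    using exists_wave_zero[OF a(6)] by blast
  interpret rank_one_rotation P J r \<theta> using a th by unfold_locales auto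
  have "A \<in> U2" using th(3) in_PP_EE wave_rate_eq_0[OF r th(3)] unfolding U2_eq
    by (auto simp add: lower_spectral_radius_eq rates_wave trace_seq_eq_0_iff)
  with th show "\<exists>\<theta>. s < \<theta> \<and> \<theta> < t \<and> (P, rot r \<theta> J) \<in> U2" by blast
qed (auto simp: U2_def)

lemma discontinuous_lower_spectral_radius:
  assumes A: "A \<in> PP \<times> EE" "lower_spectral_radius A > 0"
  shows "\<not> continuous (at A within PP \<times> EE) lower_spectral_radius"
proof
  assume "continuous (at A within PP \<times> EE) lower_spectral_radius"
  then have "\<forall>\<^sub>F A' in at A within PP \<times> EE. 0 < lower_spectral_radius A'"
    unfolding continuous_within using A(2) by (rule order_tendstoD)
  then obtain W where W: "open W" "A \<in> W" "\<And>A'. A' \<in> W \<Longrightarrow> A' \<noteq> A \<Longrightarrow> A' \<in> PP \<times> EE \<Longrightarrow> 0 < lower_spectral_radius A'"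
    unfolding eventually_at_topological by blast
  have "A \<in> top_of_set (PP \<times> EE) closure_of U2"
    using dense_U2 A(1) unfolding dense_within_def by simp
  then have "\<forall>T. A \<in> T \<and> openin (top_of_set (PP \<times> EE)) T \<longrightarrow> (\<exists>y. y \<in> U2 \<and> y \<in> T)"
    unfolding in_closure_of by (rule conjunct2)
  moreover have "A \<in> (PP \<times> EE) \<inter> W" using A(1) W(2) by (rule IntI)
  ultimately obtain A' where A': "A' \<in> U2" "A' \<in> W"
    using openin_open_Int[OF W(1)] by (metis IntD2)
  then have "lower_spectral_radius A' = 0" "A' \<in> PP \<times> EE" by (auto simp: U2_def)
  then show False using W(3)[OF A'(2)] A(2) by force
qed

lemma U3_eq: "U3 = {A \<in> PP \<times> EE. lower_spectral_radius A > 0 \<and> \<not> lower_finiteness_property A}"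
  unfolding U3_def using discontinuous_lower_spectral_radius by blast

lemma U4_eq: "U4 = {A \<in> PP \<times> EE. lower_spectral_radius A > 0 \<and> lower_finiteness_property A}"
  unfolding U4_def using discontinuous_lower_spectral_radius by blast

lemma dense_U3: "dense_within (PP \<times> EE) U3"
proof (rule dense_within_by_angle)
  fix P J :: mat2 and r s t :: real
  assume a: "det P = 0" "trace P \<noteq> 0" "J ** J = - mat 1" "r > 0" "0 \<le> s" "s < t" "t \<le> pi"
  let ?R = "wave_rate (trace P) (trace (P ** J)) r"
  obtain \<theta> where th: "s < \<theta>" "\<theta> < t" "0 < ?R \<theta>" "?R \<theta> < r"
    "\<And>k. \<bar>r ^ k * wave (trace P) (trace (P ** J)) k \<theta>\<bar> \<noteq> ?R \<theta> ^ Suc k"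
    using exists_wave_rate_not_attained[OF a(2,4,6)] by blast
  interpret rank_one_rotation P J r \<theta> using a th by unfold_locales auto
  have "A \<in> U3" using th in_PP_EE unfolding U3_eq
    by (simp add: lower_spectral_radius_eq lower_finiteness_property_iff rates_wave trace_seq_wave)
  with th show "\<exists>\<theta>. s < \<theta> \<and> \<theta> < t \<and> (P, rot r \<theta> J) \<in> U3" by blast
qed (auto simp: U3_def)

lemma (in rank_one_rotation) wave_generic_in_U4:
  assumes "wave_generic (trace P) (trace (P ** J)) \<theta>"
  shows "A \<in> U4"
  using in_PP_EE wave_generic_rate[OF r assms] unfolding U4_eq
  by (simp add: lower_spectral_radius_eq lower_finiteness_property_iff rates_wave trace_seq_wave)

lemma dense_U4: "dense_within (PP \<times> EE) U4"
proof (rule dense_within_by_angle)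
  fix P J :: mat2 and r s t :: real
  assume a: "det P = 0" "trace P \<noteq> 0" "J ** J = - mat 1" "r > 0" "0 \<le> s" "s < t" "t \<le> pi"
  obtain \<theta> where th: "s < \<theta>" "\<theta> < t" "wave_generic (trace P) (trace (P ** J)) \<theta>"
    using exists_wave_generic[OF a(2,6)] by blast
  interpret rank_one_rotation P J r \<theta> using a th by unfold_locales auto
  show "\<exists>\<theta>. s < \<theta> \<and> \<theta> < t \<and> (P, rot r \<theta> J) \<in> U4" using th wave_generic_in_U4 by blast
qed (auto simp: U4_def)

text \<open>Each \<open>W n\<close> is open because it speaks of individual continuous traces.
  Membership for all n excludes vanishing traces and bounds the radius by every 1 / (n + 1). Density
  is inherited from \<open>U1\<close>.\<close>

lemma U1_Gdelta:
  "\<exists>G :: nat \<Rightarrow> (mat2 \<times> mat2) set.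
    (\<forall>n. openin (top_of_set (PP \<times> EE)) (G n) \<and> dense_within (PP \<times> EE) (G n)) \<and> U1 = (\<Inter>n. G n)"
proof -
  define W where "W n = {A. trace_seq A n \<noteq> 0 \<and> (\<exists>k. \<bar>trace_seq A k\<bar> < (1 / Suc n) ^ Suc k)}" for n
  have W: "open (W n)" for n
    unfolding W_def
    by (intro open_Collect_conj open_Collect_ex open_Collect_less open_Collect_neq continuous_intros continuous_on_trace_seq)
  define G where "G n = (PP \<times> EE) \<inter> W n" for n
  have sub: "U1 \<subseteq> G n" for n
    using lower_spectral_radius_0D[of _ "1 / Suc n"] by (auto simp: U1_eq W_def G_def)
  have "A \<in> U1" if A: "\<And>n. A \<in> G n" for A
  proof -
    have AX: "A \<in> PP \<times> EE" using A[of 0] unfolding G_def by (rule IntD1)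
    have le: "lower_spectral_radius A \<le> 1 / Suc n" for n
    proof -
      obtain k where "\<bar>trace_seq A k\<bar> < (1 / Suc n) ^ Suc k" using A[of n] unfolding G_def W_def by blast
      then have "lower_spectral_radius A ^ Suc k \<le> (1 / Suc n) ^ Suc k"
        using lower_spectral_radius_le_trace_seq[OF AX, of k] by linarith
      then show ?thesis by (rule power_le_imp_le_base) simp
    qed
    have "lower_spectral_radius A \<le> 0"
    proof (rule field_le_epsilon)
      fix e :: real assume "e > 0"
      then obtain k where "1 / Suc k < e" using nat_approx_posE by blast
      with le[of k] show "lower_spectral_radius A \<le> 0 + e" by simp
    qed
    then have "lower_spectral_radius A = 0" using lower_spectral_radius_nonneg[OF AX] by simp
    then show ?thesis using A AX unfolding U1_eq G_def W_def by blast
  qed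
  then have "U1 = (\<Inter>n. G n)" by (intro equalityI INT_greatest sub) auto
  moreover have "openin (top_of_set (PP \<times> EE)) (G n)" for n
    unfolding G_def using W by (rule openin_open_Int)
  moreover have "dense_within (PP \<times> EE) (G n)" for n
    by (rule dense_within_superset[OF dense_U1 sub]) (simp add: G_def)
  ultimately show ?thesis by (intro exI[of _ G] conjI allI) simp_all
qed

lemma PP_EE_union: "PP \<times> EE = U1 \<union> U2 \<union> U3 \<union> U4"
  using lower_spectral_radius_nonneg unfolding U1_eq U2_eq U3_eq U4_eq by force

section \<open>Null sets\<close>

text \<open>Tonelli on the translates: integrating the slice measures over a unit interval of
  translations recovers the measure of \<open>S\<close>.\<close>
lemma negligible_of_line_slices:
  fixes S :: "'a::euclidean_space set" and e :: 'a
  assumes S: "S \<in> sets borel" and slices: "\<And>x. negligible {s::real. x + s *\<^sub>R e \<in> S}"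
  shows "negligible S"
proof -
  have slice_sets: "{s::real. x + s *\<^sub>R e \<in> S} \<in> sets borel" for x
  proof -
    have "(\<lambda>s. x + s *\<^sub>R e) -` S \<inter> space borel \<in> sets (borel :: real measure)"
      by (rule measurable_sets[OF _ S]) measurable
    then show ?thesis by (simp add: vimage_def)
  qed
  have trans_sets: "{x. x + s *\<^sub>R e \<in> S} \<in> sets borel" for s :: real
  proof -
    have "(\<lambda>x. x + s *\<^sub>R e) -` S \<inter> space borel \<in> sets borel"
      by (rule measurable_sets[OF _ S]) measurable
    then show ?thesis by (simp add: vimage_def)
  qed
  let ?f = "\<lambda>x s. indicator S (x + s *\<^sub>R e) * indicator {0..1::real} s :: ennreal"
  have [measurable]: "(\<lambda>p. ?f (fst p) (snd p)) \<in> borel_measurable (lborel \<Otimes>\<^sub>M lborel)"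
    using S by measurable
  have "(\<integral>\<^sup>+ s. \<integral>\<^sup>+ x. ?f x s \<partial>lborel \<partial>lborel) = (\<integral>\<^sup>+ x. \<integral>\<^sup>+ s. ?f x s \<partial>lborel \<partial>lborel)"
    by (rule lborel_pair.Fubini') (simp add: split_def)
  moreover have "(\<integral>\<^sup>+ s. ?f x s \<partial>lborel) = 0" for x
  proof -
    have "(\<integral>\<^sup>+ s. ?f x s \<partial>lborel) \<le> (\<integral>\<^sup>+ s. indicator {s. x + s *\<^sub>R e \<in> S} s \<partial>lborel)"
      by (intro nn_integral_mono) (auto simp: indicator_def)
    also have "\<dots> = emeasure lborel {s. x + s *\<^sub>R e \<in> S}"
      using slice_sets by (intro nn_integral_indicator) simp
    also have "\<dots> = emeasure lebesgue {s. x + s *\<^sub>R e \<in> S}"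
      using slice_sets[of x] by simp
    also have "\<dots> = 0" using slices[of x] by (auto simp: negligible_iff_null_sets)
    finally show ?thesis by simp
  qed
  moreover have "(\<integral>\<^sup>+ x. ?f x s \<partial>lborel) = emeasure lborel S * indicator {0..1} s" for s
  proof -
    have "(\<integral>\<^sup>+ x. ?f x s \<partial>lborel) = (\<integral>\<^sup>+ x. indicator {x. x + s *\<^sub>R e \<in> S} x \<partial>lborel) * indicator {0..1} s"
      using trans_sets[of s] by (subst nn_integral_multc[symmetric]) (auto simp: indicator_def)
    also have "(\<integral>\<^sup>+ x. indicator {x. x + s *\<^sub>R e \<in> S} x \<partial>lborel) = emeasure lborel {x. x + s *\<^sub>R e \<in> S}"
      using trans_sets by (intro nn_integral_indicator) simp
    also have "\<dots> = emeasure (distr lborel borel ((+) (s *\<^sub>R e))) S"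
      using S by (subst emeasure_distr) (auto simp: vimage_def add.commute)
    also have "\<dots> = emeasure lborel S" by (simp add: lborel_distr_plus)
    finally show ?thesis .
  qed
  ultimately have "(\<integral>\<^sup>+ s. emeasure lborel S * indicator {0..1::real} s \<partial>lborel) = 0" by simp
  then have "emeasure lborel S = 0"
    by (subst (asm) nn_integral_cmult_indicator) auto
  then have "emeasure lebesgue S = 0" using S by simp
  then show ?thesis using S by (auto simp: negligible_iff_null_sets intro!: null_setsI)
qed

text \<open>Passes from one chart \<sigma> with a linear left inverse \<pi> to an arbitrary smooth
  parametrization \<phi>. The transition map \<open>h\<close> is a continuous inverse of \<pi> o
  \<phi>; once it is known to be differentiable, it carries null sets to null sets.\<close>

lemma negligible_preimage_parametrization:
  fixes \<phi> :: "'a::euclidean_space \<Rightarrow> 'b::euclidean_space" and \<sigma> :: "'d::euclidean_space \<Rightarrow> 'b"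
  assumes \<phi>: "smooth_parametrization M V \<phi>" and dim: "DIM('d) \<le> DIM('a)"
    and D: "open D" "openin (top_of_set M) (\<sigma> ` D)" and \<sigma>: "\<sigma> differentiable_on D"
    and \<pi>: "linear \<pi>" "\<And>y. y \<in> D \<Longrightarrow> \<pi> (\<sigma> y) = y"
    and N: "negligible {y \<in> D. \<sigma> y \<in> N}"
  shows "negligible {x \<in> V. \<phi> x \<in> N \<inter> \<sigma> ` D}"
proof -
  have V: "open V" "smooth_on \<phi> V" "\<And>x. x \<in> V \<Longrightarrow> inj (frechet_derivative \<phi> (at x))"
    "openin (top_of_set M) (\<phi> ` V)"
    using \<phi> by (auto simp: smooth_parametrization_def)
  obtain \<psi> where \<psi>: "homeomorphism V (\<phi> ` V) \<phi> \<psi>" using \<phi> by (auto simp: smooth_parametrization_def)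
  have \<phi>_diff: "\<phi> differentiable at x" if "x \<in> V" for x
  proof -
    have "Ck_on (Suc 0) \<phi> V" using V(2) unfolding smooth_on_def by blast
    then show ?thesis using that by simp
  qed
  have \<phi>_cont: "continuous_on V \<phi>" using \<psi> by (simp add: homeomorphism_def)
  have \<sigma>_cont: "continuous_on D \<sigma>" using \<sigma> by (rule differentiable_imp_continuous_on)
  obtain O1 where O1: "open O1" "\<phi> ` V = M \<inter> O1" using V(4) openin_open by blast
  obtain O2 where O2: "open O2" "\<sigma> ` D = M \<inter> O2" using D(2) openin_open by blast
  define T where "T = {y \<in> D. \<sigma> y \<in> \<phi> ` V}"
  have "T = D \<inter> \<sigma> -` O1" unfolding T_def O1(2) using O2(2) by auto
  then have T: "open T" using continuous_open_preimage[OF \<sigma>_cont D(1) O1(1)] by simp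
  define h where "h = \<psi> \<circ> \<sigma>"
  have h: "h y \<in> V" "\<phi> (h y) = \<sigma> y" if "y \<in> T" for y
    using that \<psi> unfolding T_def h_def homeomorphism_def by auto
  have h_cont: "continuous_on T h"
    unfolding h_def using \<sigma>_cont \<psi>
    by (intro continuous_on_compose) (auto simp: T_def homeomorphism_def intro: continuous_on_subset)
  have "h differentiable at y" if y: "y \<in> T" for y
  proof -
    let ?x = "h y" and ?f = "\<pi> \<circ> \<phi>"
    let ?\<phi>' = "frechet_derivative \<phi> (at ?x)"
    have \<phi>': "(\<phi> has_derivative ?\<phi>') (at ?x)"
      using \<phi>_diff[OF h(1)[OF y]] by (simp add: frechet_derivative_works)
    have bl: "bounded_linear \<pi>" using \<pi>(1) by (simp add: linear_conv_bounded_linear)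
    have f': "(?f has_derivative (\<pi> \<circ> ?\<phi>')) (at ?x)"
      unfolding o_def using bounded_linear.has_derivative[OF bl \<phi>'] .
    have yD: "y \<in> D" using y by (simp add: T_def)
    have fy: "?f ?x = y" using h(2)[OF y] \<pi>(2)[OF yD] by simp
    have "\<sigma> differentiable at y" using \<sigma> D(1) yD by (simp add: differentiable_on_eq_differentiable_at)
    then obtain \<sigma>' where "(\<sigma> has_derivative \<sigma>') (at (?f ?x))" unfolding fy by (auto simp: differentiable_def)
    then have "(\<sigma> \<circ> ?f has_derivative \<sigma>' \<circ> (\<pi> \<circ> ?\<phi>')) (at ?x)"
      by (rule diff_chain_at[OF f'])
    moreover have "open (V \<inter> \<phi> -` O2)" using continuous_open_preimage[OF \<phi>_cont V(1) O2(1)] .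
    moreover have "?x \<in> V \<inter> \<phi> -` O2" using h[OF y] yD O2(2) by auto
    moreover have "(\<sigma> \<circ> ?f) x' = \<phi> x'" if "x' \<in> V \<inter> \<phi> -` O2" for x'
    proof -
      have "\<phi> x' \<in> \<sigma> ` D" using that O1(2) unfolding O2(2) by blast
      then show ?thesis using \<pi>(2) by auto
    qed
    \<comment> \<open>Near \<open>?x\<close> the map \<phi> takes values in the image of \<sigma>,
      so \<phi> = \<sigma> o \<pi> o \<phi> there. The injective derivative of \<phi> thus factors
      through that of \<pi> o \<phi>, which must be injective too; its left inverse is the
      derivative of \<open>h\<close>.\<close>
    ultimately have "(\<phi> has_derivative \<sigma>' \<circ> (\<pi> \<circ> ?\<phi>')) (at ?x)"
      by (rule has_derivative_transform_within_open)
    then have eq: "?\<phi>' = \<sigma>' \<circ> (\<pi> \<circ> ?\<phi>')" using \<phi>' has_derivative_unique by blast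
    have "inj (\<pi> \<circ> ?\<phi>')" using V(3)[OF h(1)[OF y]] eq by (metis inj_on_imageI2 comp_apply)
    moreover have "linear (\<pi> \<circ> ?\<phi>')" using has_derivative_linear[OF f'] .
    ultimately obtain g' where g': "linear g'" "g' \<circ> (\<pi> \<circ> ?\<phi>') = id"
      using linear_injective_left_inverse by blast
    have "(h has_derivative g') (at y)"
    proof (rule has_derivative_inverse_basic[where f = ?f and g = h and y = y, OF f' _ g'(2) _ T y])
      show "bounded_linear g'" using g'(1) by (simp add: linear_conv_bounded_linear)
      show "continuous (at y) h" using h_cont T y by (simp add: continuous_on_eq_continuous_at)
      show "?f (h z) = z" if "z \<in> T" for z
        using h(2)[OF that] \<pi>(2)[of z] that by (simp add: T_def)
    qed
    then show ?thesis by (auto simp: differentiable_def)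
  qed
  then have "h differentiable_on {y \<in> T. \<sigma> y \<in> N}"
    by (intro differentiable_at_imp_differentiable_on) simp
  moreover have "negligible {y \<in> T. \<sigma> y \<in> N}"
    by (rule negligible_subset[OF N]) (auto simp: T_def)
  ultimately have "negligible (h ` {y \<in> T. \<sigma> y \<in> N})"
    by (intro negligible_differentiable_image_negligible dim)
  moreover have "{x \<in> V. \<phi> x \<in> N \<inter> \<sigma> ` D} \<subseteq> h ` {y \<in> T. \<sigma> y \<in> N}"
  proof
    fix x assume "x \<in> {x \<in> V. \<phi> x \<in> N \<inter> \<sigma> ` D}"
    then obtain y where y: "x \<in> V" "y \<in> D" "\<phi> x = \<sigma> y" "\<sigma> y \<in> N" by auto
    then have "h y = x" using \<psi> by (simp add: h_def homeomorphism_def flip: y(3))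
    moreover have "\<sigma> y \<in> \<phi> ` V" using y(1) by (simp flip: y(3))
    then have "y \<in> {y \<in> T. \<sigma> y \<in> N}" using y by (simp add: T_def)
    ultimately show "x \<in> h ` {y \<in> T. \<sigma> y \<in> N}" by blast
  qed
  ultimately show ?thesis by (rule negligible_subset)
qed

text \<open>A matrix unit addressed relative to i: \<open>True\<close> stands for the index i and
  \<open>False\<close> for the other index, so that one formula serves both charts.\<close>

definition unit_at :: "2 \<Rightarrow> bool \<Rightarrow> bool \<Rightarrow> mat2" where
  "unit_at i u v = (\<chi> k l. if (k = i) = u \<and> (l = i) = v then 1 else 0)"

text \<open>The matrices of determinant \<open>0\<close> whose \<open>i\<close>-th diagonal entry is nonzero form a graph over
  their three other entries (one of them being that diagonal entry).\<close>
definition chart :: "2 \<Rightarrow> real \<times> real \<times> real \<times> mat2 \<Rightarrow> mat2 \<times> mat2" where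
  "chart i = (\<lambda>(a, b, c, B).
    (a *\<^sub>R unit_at i True True + b *\<^sub>R unit_at i True False + c *\<^sub>R unit_at i False True
      + (b * c / a) *\<^sub>R unit_at i False False, B))"

text \<open>The expression a + b * c / a is the trace of the reconstructed singular matrix.\<close>

definition chart_domain :: "(real \<times> real \<times> real \<times> mat2) set" where
  "chart_domain = {(a, b, c, B). a \<noteq> 0 \<and> a + b * c / a \<noteq> 0 \<and> B \<in> EE}"

definition chart_inv :: "2 \<Rightarrow> mat2 \<times> mat2 \<Rightarrow> real \<times> real \<times> real \<times> mat2" where
  "chart_inv i = (\<lambda>(P, B). let j = (if i = 1 then 2 else 1) in (P$i$i, P$i$j, P$j$i, B))"

lemma chart_entries:
  "det (fst (chart i (a, b, c, B))) = (if a = 0 then - (b * c) else 0)"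
  "trace (fst (chart i (a, b, c, B))) = a + b * c / a"
  using exhaust_2[of i] by (auto simp: chart_def unit_at_def mat2_simps)

lemma chart_inv_chart: "chart_inv i (chart i y) = y"
  using exhaust_2[of i] by (cases y) (auto simp: chart_def chart_inv_def unit_at_def Let_def)

lemma chart_chart_inv:
  assumes "det P = 0" "P$i$i \<noteq> 0"
  shows "chart i (chart_inv i (P, B)) = (P, B)"
  using exhaust_2[of i] assms
  by (auto simp: chart_def chart_inv_def unit_at_def mat2_simps Let_def field_simps)

lemma chart_in_PP_EE: "y \<in> chart_domain \<Longrightarrow> chart i y \<in> PP \<times> EE"
  using chart_entries[of i] by (cases y) (auto simp: chart_domain_def mem_Times_iff PP_iff, simp add: chart_def)

lemma chart_image: "chart i ` chart_domain = (PP \<times> EE) \<inter> {A. fst A $ i $ i \<noteq> 0}"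
proof (intro equalityI subsetI)
  fix A assume "A \<in> chart i ` chart_domain"
  then obtain y where "y \<in> chart_domain" "A = chart i y" by blast
  moreover from this have "fst A $ i $ i \<noteq> 0"
    by (cases y) (auto simp: chart_def unit_at_def chart_domain_def)
  ultimately show "A \<in> (PP \<times> EE) \<inter> {A. fst A $ i $ i \<noteq> 0}" using chart_in_PP_EE by blast
next
  fix A assume A: "A \<in> (PP \<times> EE) \<inter> {A. fst A $ i $ i \<noteq> 0}"
  obtain P B where PB: "A = (P, B)" by (cases A)
  have P: "det P = 0" "trace P \<noteq> 0" "P$i$i \<noteq> 0" "B \<in> EE" using A by (auto simp: PB PP_iff)
  have inv: "chart i (chart_inv i A) = A" unfolding PB by (rule chart_chart_inv[OF P(1,3)])
  obtain a b c B' where y: "chart_inv i A = (a, b, c, B')" by (cases "chart_inv i A")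
  have ab: "a = P$i$i" "B' = B" using y by (auto simp: PB chart_inv_def Let_def)
  have "trace P = a + b * c / a" using chart_entries(2)[of i a b c B'] inv unfolding y by (simp add: PB)
  then have "chart_inv i A \<in> chart_domain"
    unfolding y using P ab by (simp add: chart_domain_def)
  then show "A \<in> chart i ` chart_domain" using inv by (metis image_eqI)
qed

lemma linear_chart_inv: "linear (chart_inv i)"
  by (rule linearI) (auto simp: chart_inv_def Let_def)

lemma differentiable_on_chart: "chart i differentiable_on chart_domain"
proof -
  have "chart i differentiable at y" if "y \<in> chart_domain" for y
  proof -
    have y: "fst y \<noteq> 0" using that by (auto simp: chart_domain_def)
    have "(\<lambda>y. (fst y *\<^sub>R unit_at i True True + fst (snd y) *\<^sub>R unit_at i True False
      + fst (snd (snd y)) *\<^sub>R unit_at i False True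
      + (fst (snd y) * fst (snd (snd y)) / fst y) *\<^sub>R unit_at i False False, snd (snd (snd y)))) differentiable at y"
      unfolding differentiable_def using y by (auto intro!: exI derivative_eq_intros)
    then show ?thesis by (simp add: chart_def split_def)
  qed
  then show ?thesis by (rule differentiable_at_imp_differentiable_on)
qed

lemma open_chart_domain: "open chart_domain"
proof -
  let ?S = "{y :: real \<times> real \<times> real \<times> mat2. fst y \<noteq> 0}"
  have S: "open ?S" by (intro open_Collect_neq continuous_intros)
  have "open (?S \<inter> (\<lambda>y. fst y + fst (snd y) * fst (snd (snd y)) / fst y) -` (- {0}))"
    by (intro continuous_open_preimage S continuous_intros) auto
  then have 1: "open {y \<in> ?S. fst y + fst (snd y) * fst (snd (snd y)) / fst y \<noteq> 0}"
    by (simp add: vimage_def Int_def)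
  have 2: "open {y :: real \<times> real \<times> real \<times> mat2. (trace (snd (snd (snd y))))\<^sup>2 < 4 * det (snd (snd (snd y)))}"
    unfolding trace_2 det_2 by (intro open_Collect_less continuous_intros)
  have eq: "chart_domain = {y \<in> ?S. fst y + fst (snd y) * fst (snd (snd y)) / fst y \<noteq> 0}
      \<inter> {y. (trace (snd (snd (snd y))))\<^sup>2 < 4 * det (snd (snd (snd y)))}"
    by (auto simp: chart_domain_def EE_iff)
  show ?thesis unfolding eq by (intro open_Int 1 2)
qed

text \<open>\<open>wave_generic\<close> expressed without the angle and J. Only traces and a
  determinant occur, so the condition is visibly Borel in chart coordinates.\<close>

definition generic_pair :: "mat2 \<times> mat2 \<Rightarrow> bool" where
  "generic_pair A \<longleftrightarrow> (\<forall>n. trace_seq A n \<noteq> 0)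
    \<and> (\<forall>\<^sub>F n in sequentially. sqrt (det (snd A)) ^ n / (real n)\<^sup>2 \<le> \<bar>trace_seq A n\<bar>)"

lemma (in rank_one_rotation) generic_pair_iff:
  "generic_pair A \<longleftrightarrow> wave_generic (trace P) (trace (P ** J)) \<theta>"
proof -
  have "sqrt (det (snd A)) ^ n / (real n)\<^sup>2 \<le> \<bar>trace_seq A n\<bar>
      \<longleftrightarrow> 1 / (real n)\<^sup>2 \<le> \<bar>wave (trace P) (trace (P ** J)) n \<theta>\<bar>" for n
  proof -
    have "sqrt (det (snd A)) ^ n / (real n)\<^sup>2 = r ^ n * (1 / (real n)\<^sup>2)"
      by (simp add: sqrt_det_B)
    moreover have "\<bar>trace_seq A n\<bar> = r ^ n * \<bar>wave (trace P) (trace (P ** J)) n \<theta>\<bar>"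
      using r by (simp add: trace_seq_wave abs_mult)
    ultimately show ?thesis using r by (simp only: mult_le_cancel_left_pos zero_less_power)
  qed
  then show ?thesis unfolding generic_pair_def wave_generic_def trace_seq_eq_0_iff by simp
qed

lemma generic_pair_in_U4: "A \<in> PP \<times> EE \<Longrightarrow> generic_pair A \<Longrightarrow> A \<in> U4"
  by (metis PP_EE_cases rank_one_rotation.generic_pair_iff rank_one_rotation.wave_generic_in_U4)

text \<open>Adding a multiple of the identity to \<open>B\<close> keeps \<open>J\<close> and the imaginary part
  \<open>b = r sin \<theta>\<close> of the eigenvalue, so it is parametrized by \<open>b cot \<theta>\<close>.\<close>
lemma negligible_not_generic_shifts:
  assumes "(P, B) \<in> PP \<times> EE"
  shows "negligible {s. \<not> generic_pair (P, B + s *\<^sub>R mat 1)}"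
proof -
  obtain r0 \<theta>0 J where B: "r0 > 0" "0 < \<theta>0" "\<theta>0 < pi" "J ** J = - mat 1" "B = rot r0 \<theta>0 J"
    using EE_rot_cases assms by blast
  have P: "det P = 0" "trace P \<noteq> 0" using assms by (auto simp: PP_iff)
  define a where "a = r0 * cos \<theta>0"
  define b where "b = r0 * sin \<theta>0"
  have b: "b > 0" using B sin_gt_zero by (simp add: b_def)
  let ?g = "\<lambda>\<theta>. b * (cos \<theta> / sin \<theta>) - a"
  let ?N = "{\<theta>. \<not> wave_generic (trace P) (trace (P ** J)) \<theta>} \<inter> {0<..<pi}"
  have "negligible ?N"
    by (rule negligible_subset[OF negligible_not_wave_generic[OF P(2)]]) blast
  moreover have "?g differentiable_on ?N"
  proof -
    have "?g differentiable at \<theta>" if "\<theta> \<in> ?N" for \<theta>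
    proof -
      have "sin \<theta> \<noteq> 0" using that sin_gt_zero[of \<theta>] by auto
      then show ?thesis unfolding differentiable_def by (auto intro!: exI derivative_eq_intros)
    qed
    then show ?thesis by (rule differentiable_at_imp_differentiable_on)
  qed
  ultimately have "negligible (?g ` ?N)" by (intro negligible_differentiable_image_negligible) auto
  moreover have "{s. \<not> generic_pair (P, B + s *\<^sub>R mat 1)} \<subseteq> ?g ` ?N"
  proof
    fix s assume s: "s \<in> {s. \<not> generic_pair (P, B + s *\<^sub>R mat 1)}"
    obtain r \<theta> where polar: "r > 0" "0 < \<theta>" "\<theta> < pi" "a + s = r * cos \<theta>" "b = r * sin \<theta>"
      using polar_upper_half_plane[OF b, of "a + s"] by blast
    have rot: "B + s *\<^sub>R mat 1 = rot r \<theta> J"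
      unfolding B(5) rot_def polar(4)[symmetric] polar(5)[symmetric]
      by (simp add: a_def b_def algebra_simps)
    interpret rank_one_rotation P J r \<theta> using P B polar by unfold_locales auto
    have "\<not> wave_generic (trace P) (trace (P ** J)) \<theta>" using s generic_pair_iff by (simp add: rot)
    moreover have "s = ?g \<theta>"
    proof -
      have "sin \<theta> \<noteq> 0" using polar sin_gt_zero[of \<theta>] by auto
      then have "b * (cos \<theta> / sin \<theta>) = r * cos \<theta>" by (simp add: polar(5))
      then show ?thesis using polar(4) by simp
    qed
    ultimately show "s \<in> ?g ` ?N" using polar(2,3) by (intro image_eqI[of _ _ \<theta>]) auto
  qed
  ultimately show ?thesis by (rule negligible_subset)
qed

text \<open>Slices are taken along the shifts of B by multiples of the identity. These preserve P
  and the discriminant of B, so every such line lies in \<open>chart_domain\<close> or misses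
  it.\<close>

lemma negligible_chart_not_generic:
  "negligible {y \<in> chart_domain. \<not> generic_pair (chart i y)}"
proof (rule negligible_of_line_slices[where e = "(0, 0, 0, mat 1)"])
  have cont: "continuous_on chart_domain (chart i)"
    using differentiable_on_chart by (rule differentiable_imp_continuous_on)
  have D: "chart_domain \<in> sets borel" using open_chart_domain by simp
  \<comment> \<open>Extension by 0 yields Borel functions on the whole space from functions that are
    continuous only on the open chart domain.\<close>
  define f where "f n y = (if y \<in> chart_domain then trace_seq (chart i y) n else 0)" for n y
  define g where "g y = (if y \<in> chart_domain then sqrt (det (snd (chart i y))) else 0)" for y
  have [measurable]: "f n \<in> borel_measurable borel" for n
    unfolding f_def
    by (intro borel_measurable_continuous_on_if D continuous_on_compose2[OF continuous_on_trace_seq cont]) auto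
  have [measurable]: "g \<in> borel_measurable borel"
    unfolding g_def det_2 by (intro borel_measurable_continuous_on_if D continuous_intros cont)
  have "{y \<in> chart_domain. \<not> generic_pair (chart i y)}
      = chart_domain \<inter> {y \<in> space borel. (\<exists>n. f n y = 0) \<or> \<not> (\<exists>N. \<forall>n\<in>{N..}. g y ^ n / (real n)\<^sup>2 \<le> \<bar>f n y\<bar>)}"
    unfolding generic_pair_def eventually_sequentially by (auto simp: f_def g_def)
  also have "\<dots> \<in> sets borel" using D by measurable
  finally show "{y \<in> chart_domain. \<not> generic_pair (chart i y)} \<in> sets borel" .
next
  fix x :: "real \<times> real \<times> real \<times> mat2"
  obtain a b c B where x: "x = (a, b, c, B)" by (cases x)
  let ?S = "{s. x + s *\<^sub>R (0, 0, 0, mat 1) \<in> {y \<in> chart_domain. \<not> generic_pair (chart i y)}}"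
  show "negligible ?S"
  proof (cases "x \<in> chart_domain")
    case True
    obtain P where P: "chart i x = (P, B)" by (simp add: chart_def x)
    have "chart i (x + s *\<^sub>R (0, 0, 0, mat 1)) = (P, B + s *\<^sub>R mat 1)" for s
      using P by (simp add: chart_def x)
    then have "?S \<subseteq> {s. \<not> generic_pair (P, B + s *\<^sub>R mat 1)}" by auto
    moreover have "(P, B) \<in> PP \<times> EE" using chart_in_PP_EE[OF True] P by metis
    ultimately show ?thesis using negligible_not_generic_shifts negligible_subset by blast
  next
    case False
    have "B + s *\<^sub>R mat 1 \<in> EE \<longleftrightarrow> B \<in> EE" for s
      by (simp add: EE_iff mat2_simps power2_eq_square algebra_simps)
    then have "?S = {}" using False by (auto simp: x chart_domain_def)
    then show ?thesis by (simp only: negligible_empty)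
  qed
qed

lemma full_measure_U4: "full_measure_in_7_submanifold (PP \<times> EE) U4"
  unfolding full_measure_in_7_submanifold_def null_in_7_submanifold_def
proof (intro conjI allI impI)
  show "U4 \<subseteq> PP \<times> EE" by (auto simp: U4_def)
  show "PP \<times> EE - U4 \<subseteq> PP \<times> EE" by blast
  fix V :: "(real^7) set" and \<phi> :: "real^7 \<Rightarrow> mat2 \<times> mat2"
  assume \<phi>: "smooth_parametrization (PP \<times> EE) V \<phi>"
  have neg: "negligible {x \<in> V. \<phi> x \<in> (PP \<times> EE - U4) \<inter> chart i ` chart_domain}" for i
  proof (rule negligible_preimage_parametrization[OF \<phi> _ open_chart_domain _ differentiable_on_chart linear_chart_inv])
    show "DIM(real \<times> real \<times> real \<times> mat2) \<le> DIM(real^7)" by simp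
    have "open {A :: mat2 \<times> mat2. fst A $ i $ i \<noteq> 0}" by (intro open_Collect_neq continuous_intros)
    then show "openin (top_of_set (PP \<times> EE)) (chart i ` chart_domain)"
      unfolding chart_image by (rule openin_open_Int)
    show "chart_inv i (chart i y) = y" for y by (rule chart_inv_chart)
    show "negligible {y \<in> chart_domain. chart i y \<in> PP \<times> EE - U4}"
    proof (rule negligible_subset[OF negligible_chart_not_generic[of i]], rule subsetI)
      fix y assume "y \<in> {y \<in> chart_domain. chart i y \<in> PP \<times> EE - U4}"
      then have "y \<in> chart_domain" "chart i y \<in> PP \<times> EE" "chart i y \<notin> U4" by simp_all
      then show "y \<in> {y \<in> chart_domain. \<not> generic_pair (chart i y)}"
        using generic_pair_in_U4[of "chart i y"] by (intro CollectI conjI notI) simp_all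
    qed
  qed
  have "{x \<in> V. \<phi> x \<in> PP \<times> EE - U4} \<subseteq>
      (\<Union>i. {x \<in> V. \<phi> x \<in> (PP \<times> EE - U4) \<inter> chart i ` chart_domain})"
  proof
    fix x assume x: "x \<in> {x \<in> V. \<phi> x \<in> PP \<times> EE - U4}"
    then have "trace (fst (\<phi> x)) \<noteq> 0" by (auto simp: PP_iff mem_Times_iff)
    \<comment> \<open>A nonzero trace forces a nonzero diagonal entry, so the two charts cover all
      pairs.\<close>
    then obtain i where "fst (\<phi> x) $ i $ i \<noteq> 0" unfolding trace_2 by (metis add_0)
    then have "\<phi> x \<in> chart i ` chart_domain" using x unfolding chart_image by simp
    then have "x \<in> {x \<in> V. \<phi> x \<in> (PP \<times> EE - U4) \<inter> chart i ` chart_domain}" using x by simp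
    then show "x \<in> (\<Union>i. {x \<in> V. \<phi> x \<in> (PP \<times> EE - U4) \<inter> chart i ` chart_domain})"
      by (rule UN_I[OF UNIV_I])
  qed
  moreover have "negligible (\<Union>i. {x \<in> V. \<phi> x \<in> (PP \<times> EE - U4) \<inter> chart i ` chart_domain})"
  proof (rule negligible_Union)
    fix t assume "t \<in> range (\<lambda>i. {x \<in> V. \<phi> x \<in> (PP \<times> EE - U4) \<inter> chart i ` chart_domain})"
    then show "negligible t" by (rule rangeE) (simp only: neg)
  qed simp
  ultimately have "negligible {x \<in> V. \<phi> x \<in> PP \<times> EE - U4}"
    by (rule negligible_subset[rotated])
  then show "{x \<in> V. \<phi> x \<in> PP \<times> EE - U4} \<in> null_sets lebesgue"
    by (simp add: negligible_iff_null_sets)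
qed

theorem theorem1p5:
  shows "PP \<times> EE = U1 \<union> U2 \<union> U3 \<union> U4
    \<and> dense_within (PP \<times> EE) U1
    \<and> dense_within (PP \<times> EE) U2
    \<and> dense_within (PP \<times> EE) U3
    \<and> dense_within (PP \<times> EE) U4
    \<and> (\<exists>G :: nat \<Rightarrow> (mat2 \<times> mat2) set.
         (\<forall>n. openin (top_of_set (PP \<times> EE)) (G n) \<and> dense_within (PP \<times> EE) (G n))
         \<and> U1 = (\<Inter>n. G n))
    \<and> full_measure_in_7_submanifold (PP \<times> EE) U4"
  by (intro conjI PP_EE_union dense_U1 dense_U2 dense_U3 dense_U4 U1_Gdelta full_measure_U4)

end
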